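(* Let $k$ be a field and let $K/k$ be a finitely generated field extension. Let $V_\bullet$ be a graded linear series of $K/k$ which is of subfinite type. Then there exists a graded linear series of finite type $W_\bullet$ of $K/k$ such that $V_\bullet\subset W_\bullet$ and $k(V_\bullet)=k(W_\bullet)$.
   Context: Let $K[T]=\bigoplus_{n\in\mathbb N}KT^n$ be the graded polynomial ring in one variable. A graded linear series of $K/k$ is a graded sub-$k$-algebra $V_\bullet=\bigoplus_{n\in\mathbb N}V_nT^n$ of $K[T]$ such that $V_0=k$ and $V_n$ is a finite dimensional $k$-vector subspace of $K$ for every $n\geq 1$. One writes $V_\bullet\subset V'_\bullet$ (and says $V_\bullet$ is contained in $V'_\bullet$) if $V_n\subset V'_n$ for all $n\in\mathbb N$. $V_\bullet$ is of finite type if it is finitely generated as a $k$-algebra; it is of subfinite type if it is contained in some graded linear series of $K/k$ of finite type. The field of rational functions $k(V_\bullet)$ is the subextension of $K/k$ generated over $k$ by all elements $f/g$, where $f,g$ are nonzero elements of $K$ for which there is $n\geq 1$ with $\{f,g\}\subset V_n$. *)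

theory Defs
  imports
    "HOL-Algebra.UnivPoly"
    "HOL-Algebra.Embedded_Algebras"
    "HOL-Algebra.Generated_Fields"
begin

definition finitely_generated_extension :: "('a, 'b) ring_scheme \<Rightarrow> 'a set \<Rightarrow> bool"
  where "finitely_generated_extension K k \<longleftrightarrow>
    (\<exists>S. finite S \<and> S \<subseteq> carrier K \<and> carrier K = generate_field K (k \<union> S))"

text \<open>
  For a subfield \<open>k\<close> of a commutative ring \<open>R\<close>, the sub-\<open>k\<close>-algebra of \<open>R\<close> generated by \<open>S\<close>
  is the subring of \<open>R\<close> generated by \<open>k \<union> S\<close>.
\<close>

definition finitely_generated_subalgebra :: "('a, 'b) ring_scheme \<Rightarrow> 'a set \<Rightarrow> 'a set \<Rightarrow> bool"
  where "finitely_generated_subalgebra R k A \<longleftrightarrow>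
    (\<exists>S. finite S \<and> S \<subseteq> carrier R \<and> A = generate_ring R (k \<union> S))"

text \<open>
  The graded polynomial ring \<open>K[T]\<close> is \<^term>\<open>UP K\<close>, and a graded subspace
  \<open>\<Oplus>\<^sub>n V\<^sub>n T\<^sup>n\<close> of it is given by the sequence \<open>V :: nat \<Rightarrow> 'a set\<close> of its
  homogeneous components.  As an element of \<open>K[T]\<close> has only finitely many nonzero
  coefficients, it lies in this direct sum iff its \<open>n\<close>-th coefficient lies in \<open>V\<^sub>n\<close>
  for every \<open>n\<close>.
\<close>

definition graded_sum :: "('a, 'b) ring_scheme \<Rightarrow> (nat \<Rightarrow> 'a set) \<Rightarrow> (nat \<Rightarrow> 'a) set"
  where "graded_sum K V = {p \<in> carrier (UP K). \<forall>n. coeff (UP K) p n \<in> V n}"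

definition const_polys :: "('a, 'b) ring_scheme \<Rightarrow> 'a set \<Rightarrow> (nat \<Rightarrow> 'a) set"
  where "const_polys K k = (\<lambda>a. monom (UP K) a 0) ` k"

text \<open>
  \<^term>\<open>ring.finite_dimension K k E\<close> includes that \<open>E\<close> is a \<open>k\<close>-linear subspace of \<open>K\<close>.
  A sub-\<open>k\<close>-algebra of \<open>K[T]\<close> is a subring containing the constants from \<open>k\<close>; the library's
  \<^const>\<open>subalgebra\<close> does not ask for closure under multiplication.
\<close>

definition graded_linear_series :: "('a, 'b) ring_scheme \<Rightarrow> 'a set \<Rightarrow> (nat \<Rightarrow> 'a set) \<Rightarrow> bool"
  where "graded_linear_series K k V \<longleftrightarrow>
    V 0 = k \<and>
    (\<forall>n\<ge>1. ring.finite_dimension K k (V n)) \<and>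
    subring (graded_sum K V) (UP K) \<and> const_polys K k \<subseteq> graded_sum K V"

definition finite_type :: "('a, 'b) ring_scheme \<Rightarrow> 'a set \<Rightarrow> (nat \<Rightarrow> 'a set) \<Rightarrow> bool"
  where "finite_type K k V \<longleftrightarrow>
    finitely_generated_subalgebra (UP K) (const_polys K k) (graded_sum K V)"

definition contained_in :: "(nat \<Rightarrow> 'a set) \<Rightarrow> (nat \<Rightarrow> 'a set) \<Rightarrow> bool"
  where "contained_in V W \<longleftrightarrow> (\<forall>n. V n \<subseteq> W n)"

definition subfinite_type :: "('a, 'b) ring_scheme \<Rightarrow> 'a set \<Rightarrow> (nat \<Rightarrow> 'a set) \<Rightarrow> bool"
  where "subfinite_type K k V \<longleftrightarrow>
    (\<exists>W. graded_linear_series K k W \<and> finite_type K k W \<and> contained_in V W)"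

definition rational_function_field :: "('a, 'b) ring_scheme \<Rightarrow> 'a set \<Rightarrow> (nat \<Rightarrow> 'a set) \<Rightarrow> 'a set"
  where "rational_function_field K k V =
    generate_field K (k \<union> {f \<otimes>\<^bsub>K\<^esub> inv\<^bsub>K\<^esub> g | f g.
      f \<noteq> \<zero>\<^bsub>K\<^esub> \<and> g \<noteq> \<zero>\<^bsub>K\<^esub> \<and> (\<exists>n\<ge>1. {f, g} \<subseteq> V n)})"

end

theory Submission
  imports Defs "HOL-Algebra.Finite_Extensions"
begin

text \<open>
  Let \<open>F = k(V\<^sub>\<bullet>)\<close>, and suppose that some \<open>V\<^sub>n\<close> with \<open>n \<ge> 1\<close> is nonzero.  The degrees of the
  fractions of nonzero homogeneous elements of \<open>V\<^sub>\<bullet>\<close> are the multiples of some \<open>d > 0\<close>, and for a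
  fraction \<open>g\<close> of degree \<open>d\<close> every \<open>V\<^sub>d\<^sub>n\<close> is contained in \<open>F g\<^sup>n\<close>, while \<open>V\<^sub>m = 0\<close> if \<open>d\<close> does
  not divide \<open>m\<close> (\<open>exists_homogeneous_unit\<close>).  Conversely,
  a series with components \<open>B\<^sub>n g\<^sup>n\<close> in degree \<open>d n\<close>, with \<open>B\<^sub>n \<subseteq> F\<close>, and zero in the other
  degrees, has all its fractions of equal degree in \<open>F\<close>.  So it suffices to bound \<open>V\<^sub>d\<^sub>n g\<^sup>-\<^sup>n \<subseteq> F\<close> by finitely generated data
  inside \<open>F\<close>.

  A series of finite type containing \<open>V\<^sub>\<bullet>\<close> bounds \<open>V\<^sub>d\<^sub>n g\<^sup>-\<^sup>n\<close> by finitely generated data in the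
  large field: there is a finite set \<open>S\<close> such that \<open>V\<^sub>d\<^sub>n g\<^sup>-\<^sup>n\<close> lies in the \<open>k\<close>-span of the products
  of \<open>d n\<close> elements of \<open>S\<close> (\<open>weighted_span_dehomogenize\<close>).  The heart of the proof is the descent to
  \<open>F\<close> (\<open>power_span_inter_subfield\<close>): for every finite \<open>S\<close> there is a finite \<open>T \<subseteq> F\<close> such that an
  element of \<open>F\<close> which is a \<open>k\<close>-combination of products of \<open>n\<close> elements of \<open>S\<close> is also one of
  products of \<open>n\<close> elements of \<open>T\<close>, for all \<open>n\<close> simultaneously.  This is proved along a tower of
  simple extensions of \<open>F\<close>.  In an algebraic step, \<open>T\<close> consists of the matrix entries of the
  multiplications by elements of \<open>S\<close> (\<open>controls_finite_dimension\<close>); in a transcendental step, \<open>T\<close>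
  is obtained by specializing the variable to an element of \<open>F\<close> if \<open>F\<close> is infinite, and \<open>T = F\<close>
  otherwise (\<open>controls_transcendental\<close>).

  Finally the products of \<open>d n\<close> elements of \<open>T\<close> are grouped into \<open>n\<close> blocks of length \<open>d\<close>
  (\<open>power_span_homogenize\<close>), so that the series generated in degree \<open>d\<close> by the elements
  \<open>g t\<^sub>1 \<cdots> t\<^sub>d\<close> with \<open>t\<^sub>i \<in> T\<close> contains \<open>V\<^sub>\<bullet>\<close>.
\<close>

section \<open>Graded linear series generated by homogeneous elements\<close>

text \<open>
  A pair \<open>(h, m)\<close> in \<open>H\<close> stands for the homogeneous element \<open>h T\<^sup>m\<close>; the predicate describes the
  component of degree \<open>n\<close> of the \<open>k\<close>-algebra which these elements generate.  The rule for zero makes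
  the components without any monomial the zero space instead of the empty set.
\<close>

inductive weighted_combination ::
    "('a, 'b) ring_scheme \<Rightarrow> 'a set \<Rightarrow> ('a \<times> nat) set \<Rightarrow> nat \<Rightarrow> 'a \<Rightarrow> bool"
  for R (structure) and k H where
  const: "c \<in> k \<Longrightarrow> weighted_combination R k H 0 c"
| zero: "weighted_combination R k H n \<zero>"
| add: "weighted_combination R k H n x \<Longrightarrow> weighted_combination R k H n y \<Longrightarrow>
    weighted_combination R k H n (x \<oplus> y)"
| mult: "(h, m) \<in> H \<Longrightarrow> weighted_combination R k H n x \<Longrightarrow>
    weighted_combination R k H (m + n) (h \<otimes> x)"

definition weighted_span ::
    "('a, 'b) ring_scheme \<Rightarrow> 'a set \<Rightarrow> ('a \<times> nat) set \<Rightarrow> nat \<Rightarrow> 'a set"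
  where "weighted_span R k H n = {x. weighted_combination R k H n x}"

lemma weighted_span_zero_weight:
  assumes "subring k R" and "\<And>h m. (h, m) \<in> H \<Longrightarrow> 0 < m"
  shows "weighted_span R k H 0 = k"
proof -
  have "n = 0 \<longrightarrow> x \<in> k" if "weighted_combination R k H n x" for n x
    using that subringE[OF assms(1)] assms(2)
    by (induction) (auto, fastforce)
  then show ?thesis
    by (auto simp: weighted_span_def intro: weighted_combination.const)
qed

locale field_with_subfield =
  R: field R for R :: "('a, 'b) ring_scheme" (structure) +
  fixes k :: "'a set"
  assumes subfield_k: "subfield k R"
begin

lemmas k_subring = subfieldE(1)[OF subfield_k]
lemmas k_props = subringE[OF k_subring]

lemma k_carrier: "c \<in> k \<Longrightarrow> c \<in> carrier R"
  using k_props(1) by auto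

text \<open>
  Weight zero is excluded: an element of weight zero outside \<open>k\<close> would enlarge the component of
  degree zero and could make the other components infinite-dimensional.
\<close>

definition weighted_elements :: "('a \<times> nat) set \<Rightarrow> bool"
  where "weighted_elements H \<longleftrightarrow> finite H \<and> H \<subseteq> carrier R \<times> {0<..}"

lemma weighted_span_carrier:
  assumes "weighted_elements H"
  shows "weighted_span R k H n \<subseteq> carrier R"
proof -
  have "x \<in> carrier R" if "weighted_combination R k H n x" for x
    using that assms k_carrier by (induction) (auto simp: weighted_elements_def)
  then show ?thesis by (auto simp: weighted_span_def)
qed

lemma weighted_span_smult:
  assumes "weighted_elements H" "c \<in> k" "x \<in> weighted_span R k H n"
  shows "c \<otimes> x \<in> weighted_span R k H n"
proof -
  have "c \<otimes> x \<in> weighted_span R k H n" if "weighted_combination R k H n x"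
    using that
  proof (induction)
    case (const d)
    then show ?case using assms(2) k_props(6)
      by (auto simp: weighted_span_def intro: weighted_combination.const)
  next
    case (zero n)
    then show ?case using k_carrier[OF assms(2)]
      by (auto simp: weighted_span_def intro: weighted_combination.zero)
  next
    case (add n x y)
    then have "x \<in> carrier R" "y \<in> carrier R"
      using weighted_span_carrier[OF assms(1)] by (auto simp: weighted_span_def)
    then show ?case using add k_carrier[OF assms(2)]
      by (auto simp: weighted_span_def R.r_distr intro: weighted_combination.add)
  next
    case (mult h m n x)
    then have "x \<in> carrier R" "h \<in> carrier R"
      using weighted_span_carrier[OF assms(1)] assms(1)
      by (auto simp: weighted_span_def weighted_elements_def)
    then have "c \<otimes> (h \<otimes> x) = h \<otimes> (c \<otimes> x)"
      using k_carrier[OF assms(2)] by (simp add: R.m_lcomm)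
    then show ?case using mult
      by (auto simp: weighted_span_def intro: weighted_combination.mult)
  qed
  then show ?thesis using assms(3) by (simp add: weighted_span_def)
qed

lemma weighted_span_uminus:
  assumes "weighted_elements H" "x \<in> weighted_span R k H n"
  shows "\<ominus> x \<in> weighted_span R k H n"
proof -
  have "x \<in> carrier R" using weighted_span_carrier assms by auto
  then have "\<ominus> x = (\<ominus> \<one>) \<otimes> x" by (simp add: R.l_minus)
  then show ?thesis
    using weighted_span_smult[OF assms(1) k_props(5)[OF k_props(3)] assms(2)] by simp
qed

lemma weighted_span_mult:
  assumes "weighted_elements H" "x \<in> weighted_span R k H m" "y \<in> weighted_span R k H n"
  shows "x \<otimes> y \<in> weighted_span R k H (m + n)"
proof -
  have y: "y \<in> carrier R"
    using weighted_span_carrier assms by auto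
  have "x \<otimes> y \<in> weighted_span R k H (m + n)" if "weighted_combination R k H m x"
    using that
  proof (induction)
    case (const c)
    then show ?case using weighted_span_smult[OF assms(1)] assms(3) by simp
  next
    case (zero m)
    then show ?case using y
      by (auto simp: weighted_span_def intro: weighted_combination.zero)
  next
    case (add m x x')
    then have "x \<in> carrier R" "x' \<in> carrier R"
      using weighted_span_carrier[OF assms(1)] by (auto simp: weighted_span_def)
    then show ?case using add y
      by (auto simp: weighted_span_def R.l_distr intro: weighted_combination.add)
  next
    case (mult h m' m x)
    then have "x \<in> carrier R" "h \<in> carrier R"
      using weighted_span_carrier[OF assms(1)] assms(1)
      by (auto simp: weighted_span_def weighted_elements_def)
    then have "h \<otimes> x \<otimes> y = h \<otimes> (x \<otimes> y)"
      using y by (simp add: R.m_assoc)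
    then show ?case using mult
      by (auto simp: weighted_span_def add.assoc intro: weighted_combination.mult)
  qed
  then show ?thesis using assms(2) by (simp add: weighted_span_def)
qed

lemma weighted_span_add:
  "x \<in> weighted_span R k H n \<Longrightarrow> y \<in> weighted_span R k H n \<Longrightarrow> x \<oplus> y \<in> weighted_span R k H n"
  by (simp add: weighted_span_def weighted_combination.add)

lemma weighted_span_zero: "\<zero> \<in> weighted_span R k H n"
  by (simp add: weighted_span_def weighted_combination.zero)

lemma weighted_span_generator:
  assumes "weighted_elements H" "(h, m) \<in> H"
  shows "h \<in> weighted_span R k H m"
  using weighted_combination.mult[where R = R, OF assms(2) weighted_combination.const[OF k_props(3)]]
    assms by (auto simp: weighted_span_def weighted_elements_def)

lemma weighted_span_subalgebra:
  assumes "weighted_elements H"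
  shows "subalgebra k (weighted_span R k H n) R"
proof (rule subalgebra.intro)
  show "subgroup (weighted_span R k H n) (add_monoid R)"
  proof (rule R.add.subgroupI)
    show "weighted_span R k H n \<subseteq> carrier R" by (rule weighted_span_carrier[OF assms])
    show "weighted_span R k H n \<noteq> {}" using weighted_span_zero by blast
  qed (use weighted_span_add weighted_span_uminus[OF assms] in simp_all)
  show "subalgebra_axioms k (weighted_span R k H n) R"
    using weighted_span_smult[OF assms] by (auto simp: subalgebra_axioms_def)
qed

text \<open>
  There are only finitely many monomials of a given weight in finitely many elements of positive
  weight.  The spanning set is built by recursion on the weight: a nonconstant monomial is an element
  of \<open>H\<close> times a monomial of smaller weight.
\<close>

lemma finite_dimension_weighted_span:
  assumes "weighted_elements H"
  shows "R.finite_dimension k (weighted_span R k H n)"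
proof -
  have "\<exists>Us. set Us \<subseteq> carrier R \<and> (\<forall>x. weighted_combination R k H n x \<longrightarrow> x \<in> R.Span k Us)" for n
  proof (induction n rule: less_induct)
    case (less n)
    then obtain U where U: "set (U m) \<subseteq> carrier R"
        "weighted_combination R k H m x \<Longrightarrow> x \<in> R.Span k (U m)" if "m < n" for m x
      by metis
    define M where "M = insert \<one> ((\<lambda>((h, m), u). h \<otimes> u) ` (H \<times> (\<Union>m\<in>{..<n}. set (U m))))"
    have "finite M" using assms by (simp add: M_def weighted_elements_def)
    then obtain Us where Us: "set Us = M" using finite_list by blast
    have carr: "set Us \<subseteq> carrier R"
    proof
      fix x assume "x \<in> set Us"
      then consider "x = \<one>" | h m u n' where "x = h \<otimes> u" "(h, m) \<in> H" "n' < n" "u \<in> set (U n')"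
        unfolding Us M_def by auto
      then show "x \<in> carrier R"
      proof cases
        case 2
        then show ?thesis using U(1)[OF 2(3)] assms by (auto simp: weighted_elements_def)
      qed simp
    qed
    have "x \<in> R.Span k Us" if "weighted_combination R k H n' x" "n' = n" for n' x
      using that
    proof (induction)
      case (const c)
      have "\<one> \<in> R.Span k Us"
        using R.Span_base_incl[OF subfield_k carr] Us M_def by auto
      then show ?case
        using R.Span_smult_closed[OF subfield_k carr const(1)] k_carrier[OF const(1)] by fastforce
    next
      case (zero n)
      then show ?case using R.Span_subgroup_props(2)[OF subfield_k carr] by simp
    next
      case (add n x y)
      then show ?case using R.Span_subgroup_props(3)[OF subfield_k carr] by simp
    next
      case (mult h m n1 x)
      have h: "h \<in> carrier R" "m > 0"
        using assms mult(1) by (auto simp: weighted_elements_def)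
      then have n1: "n1 < n" "n - m = n1" using mult by auto
      then have "x \<in> R.Span k (U n1)" using U(2) mult by auto
      then obtain Ks where Ks: "set Ks \<subseteq> k" "x = R.combine Ks (U n1)"
        using R.Span_mem_iff_length_version[OF subfield_k U(1)[OF n1(1)]] by blast
      have "h \<otimes> x = R.combine Ks (map ((\<otimes>) h) (U n1))"
      proof -
        have "set Ks \<subseteq> carrier R" using Ks(1) k_carrier by auto
        then have "x \<otimes> h = R.combine Ks (map (\<lambda>u. u \<otimes> h) (U n1))"
          using R.combine_l_distr[of Ks "U n1" h] U(1)[OF n1(1)] h Ks by auto
        moreover have "map (\<lambda>u. u \<otimes> h) (U n1) = map ((\<otimes>) h) (U n1)"
          using U(1)[OF n1(1)] h R.m_comm by auto
        moreover have "x \<in> carrier R"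
          using weighted_span_carrier[OF assms] mult by (auto simp: weighted_span_def)
        ultimately show ?thesis using h R.m_comm by auto
      qed
      also have "\<dots> \<in> R.Span k (map ((\<otimes>) h) (U n1))"
      proof -
        have "set (map ((\<otimes>) h) (U n1)) \<subseteq> carrier R" using U(1)[OF n1(1)] h by auto
        from R.Span_eq_combine_set[OF subfield_k this] show ?thesis using Ks(1) by blast
      qed
      also have "\<dots> \<subseteq> R.Span k Us"
      proof (rule R.mono_Span_sublist[OF subfield_k _ carr])
        show "set (map ((\<otimes>) h) (U n1)) \<subseteq> set Us"
        proof
          fix x assume "x \<in> set (map ((\<otimes>) h) (U n1))"
          then obtain u where "u \<in> set (U n1)" "x = h \<otimes> u" by auto
          then have "x \<in> (\<lambda>((h, m), u). h \<otimes> u) ` (H \<times> (\<Union>m\<in>{..<n}. set (U m)))"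
            using mult(1) n1(1) by (intro image_eqI[of _ _ "((h, m), u)"]) auto
          then show "x \<in> set Us" unfolding Us M_def by blast
        qed
      qed
      finally show ?case .
    qed
    then show ?case using carr by blast
  qed
  then obtain Us where Us: "set Us \<subseteq> carrier R" "weighted_span R k H n \<subseteq> R.Span k Us"
    unfolding weighted_span_def by blast
  show ?thesis
    by (rule R.subalbegra_incl_imp_finite_dimension[OF subfield_k
          R.Span_finite_dimension[OF subfield_k Us(1)] weighted_span_subalgebra[OF assms] Us(2)])
qed

text \<open>
  Membership of the monomial in the graded sum needs \<open>0\<close> in every component, which holds because
  the components are subspaces.
\<close>

lemma graded_linear_series_carrier:
  assumes "graded_linear_series R k V" "x \<in> V n"
  shows "x \<in> carrier R" "up_ring.monom (UP R) x n \<in> graded_sum R V"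
proof -
  interpret P: UP_cring R "UP R" by unfold_locales
  have sa: "subalgebra k (V m) R" for m
  proof (cases "m = 0")
    case True
    then show ?thesis using assms(1) R.finite_dimension_imp_subalgebra[OF subfield_k]
        R.dimension_one[OF subfield_k] R.finite_dimensionI
      unfolding graded_linear_series_def by metis
  next
    case False
    then show ?thesis using assms(1) R.finite_dimension_imp_subalgebra[OF subfield_k]
      unfolding graded_linear_series_def by auto
  qed
  have z: "\<zero> \<in> V m" for m
    using subgroup.one_closed[OF subalgebra.axioms(1)[OF sa]] by simp
  show xc: "x \<in> carrier R" using R.subalgebra_in_carrier[OF sa] assms(2) by blast
  then show "up_ring.monom (UP R) x n \<in> graded_sum R V"
    using assms(2) z by (auto simp: graded_sum_def)
qed

lemma subring_graded_sum:
  assumes "\<And>n. subalgebra k (W n) R" "\<one> \<in> W 0"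
    and "\<And>m n x y. x \<in> W m \<Longrightarrow> y \<in> W n \<Longrightarrow> x \<otimes> y \<in> W (m + n)"
  shows "subring (graded_sum R W) (UP R)"
proof -
  interpret P: UP_cring R "UP R" by unfold_locales
  have grp: "subgroup (W n) (add_monoid R)" for n using assms(1) subalgebra.axioms by blast
  have W: "W n \<subseteq> carrier R" "\<zero> \<in> W n" for n
    using subgroup.subset[OF grp] subgroup.one_closed[OF grp] by auto
  have Wa: "x \<oplus> y \<in> W n" if "x \<in> W n" "y \<in> W n" for x y n
    using subgroup.m_closed[OF grp that] by simp
  have Wm: "\<ominus> x \<in> W n" if "x \<in> W n" for x n
    using subgroup.m_inv_closed[OF grp that] by (simp add: a_inv_def)
  have fs: "(\<Oplus>i\<in>A. f i) \<in> W n" if "finite A" "\<And>i. i \<in> A \<Longrightarrow> f i \<in> W n" for f n and A :: "nat set"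
    using that
  proof (induction A)
    case (insert a A)
    then have "f \<in> A \<rightarrow> carrier R" "f a \<in> carrier R" using W by blast+
    then show ?case using insert Wa by simp
  qed (simp add: W)
  show ?thesis
  proof (rule P.P.subringI)
    show "graded_sum R W \<subseteq> carrier (UP R)" by (auto simp: graded_sum_def)
    show "\<one>\<^bsub>UP R\<^esub> \<in> graded_sum R W" using assms(2) W by (auto simp: graded_sum_def)
    show "\<ominus>\<^bsub>UP R\<^esub> p \<in> graded_sum R W" if "p \<in> graded_sum R W" for p
      using that Wm by (auto simp: graded_sum_def)
    show "p \<oplus>\<^bsub>UP R\<^esub> q \<in> graded_sum R W" if "p \<in> graded_sum R W" "q \<in> graded_sum R W" for p q
      using that Wa by (auto simp: graded_sum_def)
    show "p \<otimes>\<^bsub>UP R\<^esub> q \<in> graded_sum R W" if "p \<in> graded_sum R W" "q \<in> graded_sum R W" for p q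
    proof -
      have "up_ring.coeff (UP R) p i \<otimes> up_ring.coeff (UP R) q (n - i) \<in> W n" if "i \<le> n" for i n
        using assms(3)[of "up_ring.coeff (UP R) p i" i "up_ring.coeff (UP R) q (n - i)" "n - i"] that
          \<open>p \<in> _\<close> \<open>q \<in> _\<close> by (auto simp: graded_sum_def)
      then have "(\<Oplus>i\<in>{..n}. up_ring.coeff (UP R) p i \<otimes> up_ring.coeff (UP R) q (n - i)) \<in> W n" for n
        by (intro fs) auto
      then show ?thesis using that by (simp add: graded_sum_def)
    qed
  qed
qed

lemma subring_graded_sum_weighted_span:
  assumes "weighted_elements H"
  shows "subring (graded_sum R (weighted_span R k H)) (UP R)"
  using weighted_span_subalgebra[OF assms] weighted_span_mult[OF assms] k_props(3)
  by (intro subring_graded_sum) (auto simp: weighted_span_def intro: weighted_combination.const)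

lemma const_polys_weighted_span:
  assumes "weighted_elements H"
  shows "const_polys R k \<subseteq> graded_sum R (weighted_span R k H)"
proof -
  interpret P: UP_cring R "UP R" by unfold_locales
  show ?thesis
    using k_carrier weighted_span_zero
    by (auto simp: const_polys_def graded_sum_def weighted_span_def intro: weighted_combination.const)
qed

lemma graded_linear_series_weighted_span:
  assumes "weighted_elements H"
  shows "graded_linear_series R k (weighted_span R k H)"
  unfolding graded_linear_series_def
proof (intro conjI allI impI)
  show "weighted_span R k H 0 = k"
    using assms by (intro weighted_span_zero_weight[OF k_subring]) (auto simp: weighted_elements_def)
qed (use assms finite_dimension_weighted_span subring_graded_sum_weighted_span
    const_polys_weighted_span in auto)

lemma finite_type_weighted_span:
  assumes "weighted_elements H"
  shows "finite_type R k (weighted_span R k H)"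
proof -
  interpret P: UP_cring R "UP R" by unfold_locales
  define S where "S = (\<lambda>(h, m). up_ring.monom (UP R) h m) ` H"
  let ?G = "graded_sum R (weighted_span R k H)"
  have S: "finite S" "S \<subseteq> carrier (UP R)"
    using assms by (auto simp: S_def weighted_elements_def)
  have c: "const_polys R k \<subseteq> carrier (UP R)"
    using k_carrier by (auto simp: const_polys_def)
  have gr: "subring (generate_ring (UP R) (const_polys R k \<union> S)) (UP R)"
    using S c by (intro P.P.generate_ring_is_subring) auto
  note gE = subringE[OF gr]
  have "S \<subseteq> ?G"
  proof
    fix p assume "p \<in> S"
    then obtain h m where hm: "(h, m) \<in> H" "p = up_ring.monom (UP R) h m" by (auto simp: S_def)
    have "h \<in> carrier R" using assms hm by (auto simp: weighted_elements_def)
    then show "p \<in> ?G"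
      using hm weighted_span_generator[OF assms hm(1)] weighted_span_zero
      by (simp add: graded_sum_def)
  qed
  then have "generate_ring (UP R) (const_polys R k \<union> S) \<subseteq> ?G"
    using S c const_polys_weighted_span[OF assms]
    by (intro P.P.generate_ring_min_subring1 subring_graded_sum_weighted_span[OF assms]) auto
  moreover have "?G \<subseteq> generate_ring (UP R) (const_polys R k \<union> S)"
  proof
    fix p assume p: "p \<in> ?G"
    have mon: "up_ring.monom (UP R) x n \<in> generate_ring (UP R) (const_polys R k \<union> S)"
      if "weighted_combination R k H n x" for n x
      using that
    proof (induction)
      case (const c)
      then show ?case by (intro generate_ring.incl) (auto simp: const_polys_def)
    next
      case (zero n)
      then show ?case using gE(2) by simp
    next
      case (add n x y)
      then have "x \<in> carrier R" "y \<in> carrier R"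
        using weighted_span_carrier[OF assms] by (auto simp: weighted_span_def)
      then show ?case using add gE(7) by simp
    next
      case (mult h m n x)
      then have "x \<in> carrier R" "h \<in> carrier R"
        using weighted_span_carrier[OF assms] assms
        by (auto simp: weighted_span_def weighted_elements_def)
      moreover have "up_ring.monom (UP R) h m \<in> generate_ring (UP R) (const_polys R k \<union> S)"
        using mult(1) by (intro generate_ring.incl) (force simp: S_def)
      ultimately show ?case using mult gE(6) by simp
    qed
    have pc: "p \<in> carrier (UP R)" using p by (simp add: graded_sum_def)
    have "finsum (UP R) (\<lambda>i. up_ring.monom (UP R) (up_ring.coeff (UP R) p i) i) {..n}
      \<in> generate_ring (UP R) (const_polys R k \<union> S)" for n
    proof -
      have "up_ring.monom (UP R) (up_ring.coeff (UP R) p i) i \<in> generate_ring (UP R) (const_polys R k \<union> S)" for i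
        using mon p by (auto simp: graded_sum_def weighted_span_def)
      then show ?thesis using pc gE(7)
        by (induction n) (auto simp: P.P.finsum_Suc)
    qed
    from this[of "deg R p"] show "p \<in> generate_ring (UP R) (const_polys R k \<union> S)"
      using P.up_repr[OF pc] by simp
  qed
  ultimately show ?thesis
    unfolding finite_type_def finitely_generated_subalgebra_def using S by blast
qed

text \<open>
  The homogeneous components of positive degree of the given generators form \<open>H\<close>; the constant terms
  of the generators may be omitted since they lie in the component of degree zero, which is \<open>k\<close>.
\<close>

lemma finite_type_contained_in_weighted_span:
  assumes "graded_linear_series R k U" "finite_type R k U"
  obtains H where "weighted_elements H" "\<And>n. U n \<subseteq> weighted_span R k H n"
proof -
  interpret P: UP_cring R "UP R" by unfold_locales
  obtain S where S: "finite S" "S \<subseteq> carrier (UP R)"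
    "graded_sum R U = generate_ring (UP R) (const_polys R k \<union> S)"
    using assms(2) unfolding finite_type_def finitely_generated_subalgebra_def by blast
  define H where "H = (\<Union>p\<in>S. (\<lambda>m. (up_ring.coeff (UP R) p m, m)) ` {0<..deg R p})"
  have H: "weighted_elements H"
    using S by (auto simp: weighted_elements_def H_def)
  have coeff: "up_ring.coeff (UP R) p n \<in> weighted_span R k H n" if "p \<in> S" for p n
  proof -
    consider "n = 0" | "0 < n" "n \<le> deg R p" | "deg R p < n" by linarith
    then show ?thesis
    proof cases
      case 1
      have "p \<in> graded_sum R U" unfolding S(3) using that by (simp add: generate_ring.incl)
      then have "up_ring.coeff (UP R) p 0 \<in> k"
        using assms(1) unfolding graded_sum_def graded_linear_series_def by auto
      then show ?thesis using 1 by (auto simp: weighted_span_def intro: weighted_combination.const)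
    next
      case 2
      then show ?thesis using that by (intro weighted_span_generator[OF H]) (force simp: H_def)
    next
      case 3
      then show ?thesis using P.deg_aboveD[of p n] that S weighted_span_zero by auto
    qed
  qed
  have "S \<subseteq> graded_sum R (weighted_span R k H)"
    using S coeff by (auto simp: graded_sum_def)
  moreover have "const_polys R k \<subseteq> carrier (UP R)"
    using k_carrier by (auto simp: const_polys_def)
  ultimately have sub: "graded_sum R U \<subseteq> graded_sum R (weighted_span R k H)"
    unfolding S(3) using S(2) const_polys_weighted_span[OF H]
    by (intro P.P.generate_ring_min_subring1 subring_graded_sum_weighted_span[OF H]) auto
  have "U n \<subseteq> weighted_span R k H n" for n
  proof
    fix x assume x: "x \<in> U n"
    have xc: "x \<in> carrier R" and "up_ring.monom (UP R) x n \<in> graded_sum R U"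
      using graded_linear_series_carrier[OF assms(1) x] by auto
    then have "up_ring.coeff (UP R) (up_ring.monom (UP R) x n) n \<in> weighted_span R k H n"
      using sub unfolding graded_sum_def by blast
    then show "x \<in> weighted_span R k H n" using xc by simp
  qed
  with H that show ?thesis by blast
qed

section \<open>Descent of spans of products to a subfield\<close>

text \<open>
  The \<open>k\<close>-span of the products of exactly \<open>n\<close> elements of \<open>S\<close>, that is, the \<open>n\<close>-th power of the
  subspace generated by \<open>S\<close>.
\<close>

definition power_span :: "'a set \<Rightarrow> nat \<Rightarrow> 'a set"
  where "power_span S n = weighted_span R k (S \<times> {1}) n"

lemma power_span_const: "c \<in> k \<Longrightarrow> c \<in> power_span S 0"
  by (simp add: power_span_def weighted_span_def weighted_combination.const)

lemma power_span_zero: "\<zero> \<in> power_span S n"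
  by (simp add: power_span_def weighted_span_zero)

lemma power_span_add: "x \<in> power_span S n \<Longrightarrow> y \<in> power_span S n \<Longrightarrow> x \<oplus> y \<in> power_span S n"
  by (simp add: power_span_def weighted_span_add)

lemma power_span_mult: "s \<in> S \<Longrightarrow> x \<in> power_span S n \<Longrightarrow> s \<otimes> x \<in> power_span S (Suc n)"
  using weighted_combination.mult[of s 1 "S \<times> {1}" R k n x]
  by (simp add: power_span_def weighted_span_def)

lemma power_span_induct [consumes 1, case_names const zero add mult]:
  assumes "x \<in> power_span S n"
    and const: "\<And>c. c \<in> k \<Longrightarrow> P 0 c"
    and zero: "\<And>n. P n \<zero>"
    and add: "\<And>n x y. \<lbrakk>x \<in> power_span S n; P n x; y \<in> power_span S n; P n y\<rbrakk> \<Longrightarrow> P n (x \<oplus> y)"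
    and mult: "\<And>s n x. \<lbrakk>s \<in> S; x \<in> power_span S n; P n x\<rbrakk> \<Longrightarrow> P (Suc n) (s \<otimes> x)"
  shows "P n x"
proof -
  have "weighted_combination R k (S \<times> {1}) n x"
    using assms(1) by (simp add: power_span_def weighted_span_def)
  then show ?thesis
  proof (induction)
    case (mult h m n x)
    then show ?case using assms(5)[of h x n] by (simp add: power_span_def weighted_span_def)
  qed (use assms in \<open>simp_all add: power_span_def weighted_span_def\<close>)
qed

lemma power_span_subset:
  assumes "subring F R" "k \<subseteq> F" "S \<subseteq> F"
  shows "power_span S n \<subseteq> F"
proof
  fix x assume "x \<in> power_span S n"
  then show "x \<in> F"
    using subringE[OF assms(1)] assms(2,3) by (induction rule: power_span_induct) auto
qed

lemma power_span_carrier: "S \<subseteq> carrier R \<Longrightarrow> power_span S n \<subseteq> carrier R"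
  using k_props(1) R.carrier_is_subring by (intro power_span_subset) auto

lemma power_span_0: "power_span S 0 = k"
  unfolding power_span_def using k_subring by (intro weighted_span_zero_weight) auto

text \<open>
  The same \<open>T\<close> has to work for all \<open>n\<close>, with the same number of factors.  This uniformity is what
  turns a statement about algebras into one about graded algebras.
\<close>

definition controls :: "'a set \<Rightarrow> 'a set \<Rightarrow> bool"
  where "controls F E \<longleftrightarrow> (\<forall>S. finite S \<and> S \<subseteq> E \<longrightarrow>
    (\<exists>T. finite T \<and> T \<subseteq> F \<and> (\<forall>n. power_span S n \<inter> F \<subseteq> power_span T n)))"

lemma controls_refl: "controls F F"
  unfolding controls_def by blast

lemma controls_trans:
  assumes "F \<subseteq> E" "controls F E" "controls E E'"
  shows "controls F E'"
  unfolding controls_def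
proof (intro allI impI)
  fix S assume "finite S \<and> S \<subseteq> E'"
  then obtain S' where S': "finite S'" "S' \<subseteq> E" "\<And>n. power_span S n \<inter> E \<subseteq> power_span S' n"
    using assms(3) unfolding controls_def by meson
  then obtain T where T: "finite T" "T \<subseteq> F" "\<And>n. power_span S' n \<inter> F \<subseteq> power_span T n"
    using assms(2) unfolding controls_def by meson
  show "\<exists>T. finite T \<and> T \<subseteq> F \<and> (\<forall>n. power_span S n \<inter> F \<subseteq> power_span T n)"
  proof (intro exI[of _ T] conjI allI)
    show "power_span S n \<inter> F \<subseteq> power_span T n" for n
      using S'(3)[of n] assms(1) T(3)[of n] by blast
  qed (rule T)+
qed

text \<open>
  Extend \<open>1\<close> to a basis of \<open>E\<close> over \<open>F\<close> and let \<open>T\<close> collect the entries of the matrices of the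
  multiplications by the elements of \<open>S\<close>.  Each further factor from \<open>S\<close> multiplies the vector of
  coordinates by such a matrix, so the coordinates of a product of \<open>n\<close> factors are sums of products of
  \<open>n\<close> elements of \<open>T\<close>.  An element of \<open>F\<close> is its own coordinate at the basis vector \<open>1\<close>.
\<close>

lemma controls_finite_dimension:
  assumes F: "subfield F R" "k \<subseteq> F" and E: "subring E R" "F \<subseteq> E" "R.finite_dimension F E"
  shows "controls F E"
  unfolding controls_def
proof (intro allI impI)
  fix S assume S: "finite S \<and> S \<subseteq> E"
  note Fr = subringE[OF subfieldE(1)[OF F(1)]]
  obtain d where d: "R.dimension d F E" using E(3) R.finite_dimensionE' by blast
  have "R.independent F [\<one>]" by (rule R.li_Cons) auto
  moreover have "set [\<one>] \<subseteq> E" using subringE(3)[OF E(1)] by simp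
  ultimately obtain Vs where Vs: "R.independent F (Vs @ [\<one>])" "R.Span F (Vs @ [\<one>]) = E"
    using R.complete_base[OF F(1) d] by blast
  define Us where "Us = Vs @ [\<one>]"
  have ind: "R.independent F Us" and Sp: "R.Span F Us = E" using Vs by (auto simp: Us_def)
  have Uc: "set Us \<subseteq> carrier R" using R.independent_in_carrier[OF ind] .
  have Vc: "set Vs \<subseteq> carrier R" using Uc by (simp add: Us_def)
  have UE: "set Us \<subseteq> E" using R.Span_base_incl[OF F(1) Uc] Sp by simp
  have "\<exists>Ks. length Ks = length Us \<and> set Ks \<subseteq> F \<and> s \<otimes> u = R.combine Ks Us"
    if "s \<in> S" "u \<in> set Us" for s u
  proof -
    have "s \<otimes> u \<in> R.Span F Us" using subringE(6)[OF E(1)] that S UE Sp by auto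
    then show ?thesis using R.Span_mem_iff_length_version[OF F(1) Uc] by blast
  qed
  then obtain M where M: "\<And>s u. s \<in> S \<Longrightarrow> u \<in> set Us \<Longrightarrow>
      length (M s u) = length Us \<and> set (M s u) \<subseteq> F \<and> s \<otimes> u = R.combine (M s u) Us"
    by metis
  define T where "T = (\<Union>s\<in>S. \<Union>u\<in>set Us. set (M s u))"
  have T: "finite T" "T \<subseteq> F" using S M by (auto simp: T_def)
  have Tc: "T \<subseteq> carrier R" using T Fr(1) by auto
  have Pc: "power_span T n \<subseteq> carrier R" for n using power_span_carrier[OF Tc] .
  \<comment> \<open>the basis vector \<open>1\<close> comes last\<close>
  have coord: "R.combine (replicate (length Vs) \<zero> @ [c]) Us = c" if "c \<in> carrier R" for c
    using R.combine_append[of "replicate (length Vs) \<zero>" Vs "[c]" "[\<one>]"] that Vc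
      R.combine_replicate[OF Vc]
    by (auto simp: Us_def set_replicate_conv_if)
  let ?rep = "\<lambda>n x. \<exists>Ks. length Ks = length Us \<and> set Ks \<subseteq> power_span T n \<and> x = R.combine Ks Us"
  have rep_zero: "?rep n \<zero>" for n
    using R.combine_replicate[OF Uc] power_span_zero[of T n]
    by (intro exI[of _ "replicate (length Us) \<zero>"]) (auto simp: set_replicate_conv_if)
  have rep_add: "?rep n (x \<oplus> y)" if x: "?rep n x" and y: "?rep n y" for n x y
  proof -
    obtain Ks Ls where K: "length Ks = length Us" "set Ks \<subseteq> power_span T n" "x = R.combine Ks Us"
      and L: "length Ls = length Us" "set Ls \<subseteq> power_span T n" "y = R.combine Ls Us"
      using x y by blast
    have "x \<oplus> y = R.combine (map2 (\<oplus>) Ks Ls) Us"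
      unfolding K L using K L Pc[of n] Uc by (intro R.combine_add) auto
    moreover have "set (map2 (\<oplus>) Ks Ls) \<subseteq> power_span T n"
      using K(2) L(2) by (auto intro!: power_span_add dest: set_zip_leftD set_zip_rightD)
    ultimately show ?thesis using K(1) L(1) by (intro exI[of _ "map2 (\<oplus>) Ks Ls"]) auto
  qed
  have rep_mult: "?rep (Suc n) (s \<otimes> R.combine Ks Ws)"
    if "length Ks = length Ws" "set Ks \<subseteq> power_span T n" "set Ws \<subseteq> set Us" "s \<in> S" for n s Ks Ws
    using that
  proof (induction Ks Ws rule: list_induct2)
    case Nil
    have "s \<in> carrier R" using Nil S subringE(1)[OF E(1)] by auto
    then show ?case using rep_zero by simp
  next
    case (Cons a Ks w Ws)
    have c: "s \<in> carrier R" "a \<in> carrier R" "w \<in> carrier R"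
        "set Ks \<subseteq> carrier R" "set Ws \<subseteq> carrier R"
      using Cons.prems S subringE(1)[OF E(1)] Pc[of n] Uc by auto
    have Mw: "length (M s w) = length Us" "set (M s w) \<subseteq> T" "s \<otimes> w = R.combine (M s w) Us"
      using M[of s w] Cons.prems by (auto simp: T_def)
    have "a \<otimes> (s \<otimes> w) = R.combine (map ((\<otimes>) a) (M s w)) Us"
      unfolding Mw(3) using Mw(2) Tc Uc c(2) by (intro R.combine_r_distr) auto
    moreover have "set (map ((\<otimes>) a) (M s w)) \<subseteq> power_span T (Suc n)"
    proof
      fix x assume "x \<in> set (map ((\<otimes>) a) (M s w))"
      then obtain t where t: "t \<in> T" "x = a \<otimes> t" using Mw(2) by auto
      then have "x = t \<otimes> a" using c(2) Tc R.m_comm by auto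
      then show "x \<in> power_span T (Suc n)" using power_span_mult[OF t(1)] Cons.prems by auto
    qed
    ultimately have 1: "?rep (Suc n) (a \<otimes> (s \<otimes> w))"
      using Mw(1) by (intro exI[of _ "map ((\<otimes>) a) (M s w)"]) auto
    have 2: "?rep (Suc n) (s \<otimes> R.combine Ks Ws)" using Cons by auto
    have "s \<otimes> R.combine (a # Ks) (w # Ws) = a \<otimes> (s \<otimes> w) \<oplus> s \<otimes> R.combine Ks Ws"
      using c by (simp add: R.r_distr R.m_lcomm)
    then show ?case using rep_add[OF 1 2] by simp
  qed
  have rep: "?rep n x" if "x \<in> power_span S n" for n x
    using that
  proof (induction rule: power_span_induct)
    case (const c)
    then show ?case
      using coord[OF k_carrier[OF const]] power_span_const[OF const] power_span_zero[of T 0]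
      by (intro exI[of _ "replicate (length Vs) \<zero> @ [c]"]) (auto simp: Us_def set_replicate_conv_if)
  next
    case (mult s n x)
    then show ?case using rep_mult[of _ Us n s] by auto
  qed (use rep_zero rep_add in auto)
  have "power_span S n \<inter> F \<subseteq> power_span T n" for n
  proof
    fix x assume x: "x \<in> power_span S n \<inter> F"
    then obtain Ks where Ks: "length Ks = length Us" "set Ks \<subseteq> power_span T n" "x = R.combine Ks Us"
      using rep by blast
    let ?Ls = "replicate (length Vs) \<zero> @ [x]"
    have "set Ks \<subseteq> F" using Ks(2) power_span_subset[OF subfieldE(1)[OF F(1)] F(2) T(2)] by blast
    moreover have "set ?Ls \<subseteq> F" using x Fr(2) by auto
    moreover have "length ?Ls = length Us" by (simp add: Us_def)
    moreover have "x = R.combine ?Ls Us" using coord[of x] x Fr(1) by auto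
    moreover have "x \<in> R.Span F Us" using Sp x E(2) by auto
    ultimately have "Ks = ?Ls"
      using R.unique_decomposition[OF F(1) ind, of x] Ks by blast
    then show "x \<in> power_span T n" using Ks(2) by simp
  qed
  then show "\<exists>T. finite T \<and> T \<subseteq> F \<and> (\<forall>n. power_span S n \<inter> F \<subseteq> power_span T n)"
    using T by blast
qed

text \<open>
  If every element of \<open>S\<close> is a fraction of elements of \<open>D\<close> whose denominator survives under a
  retraction \<open>\<psi>\<close> of \<open>D\<close> onto \<open>F\<close>, then \<open>\<psi>\<close> extends to these fractions and to their products, and it
  fixes the ones that lie in \<open>F\<close>.  That \<open>y\<close> is the image of \<open>x\<close> is expressed by \<open>\<psi> a = \<psi> b \<otimes> y\<close>
  for some \<open>a\<close> and \<open>b\<close> with \<open>b \<otimes> x = a\<close>, which keeps inverses out of the induction.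
\<close>

lemma controls_by_specialization:
  assumes F: "subfield F R" "k \<subseteq> F" and D: "subring D R" "F \<subseteq> D"
    and \<psi>: "\<And>x. x \<in> D \<Longrightarrow> \<psi> x \<in> F" "\<And>x y. x \<in> D \<Longrightarrow> y \<in> D \<Longrightarrow> \<psi> (x \<oplus> y) = \<psi> x \<oplus> \<psi> y"
      "\<And>x y. x \<in> D \<Longrightarrow> y \<in> D \<Longrightarrow> \<psi> (x \<otimes> y) = \<psi> x \<otimes> \<psi> y" "\<And>c. c \<in> F \<Longrightarrow> \<psi> c = c"
    and S: "finite S" "S \<subseteq> carrier R"
      "\<And>s. s \<in> S \<Longrightarrow> \<exists>a\<in>D. \<exists>b\<in>D. \<psi> b \<noteq> \<zero> \<and> b \<otimes> s = a"
  shows "\<exists>T. finite T \<and> T \<subseteq> F \<and> (\<forall>n. power_span S n \<inter> F \<subseteq> power_span T n)"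
proof -
  note Fr = subringE[OF subfieldE(1)[OF F(1)]]
  note Dr = subringE[OF D(1)]
  have Dc: "x \<in> carrier R" "\<psi> x \<in> carrier R" if "x \<in> D" for x using that Dr(1) Fr(1) \<psi>(1) by auto
  have "\<exists>t\<in>F. \<exists>a\<in>D. \<exists>b\<in>D. \<psi> b \<noteq> \<zero> \<and> b \<otimes> s = a \<and> \<psi> a = \<psi> b \<otimes> t" if s: "s \<in> S" for s
  proof -
    obtain a b where ab: "a \<in> D" "b \<in> D" "\<psi> b \<noteq> \<zero>" "b \<otimes> s = a" using S(3)[OF s] by blast
    have i: "inv (\<psi> b) \<in> F" "\<psi> b \<otimes> inv (\<psi> b) = \<one>"
      using R.subfield_m_inv[OF F(1), of "\<psi> b"] ab \<psi>(1) by auto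
    have "\<psi> b \<otimes> (inv (\<psi> b) \<otimes> \<psi> a) = \<psi> a"
      using i Dc(2)[OF ab(1)] Dc(2)[OF ab(2)] Fr(1) by (subst R.m_assoc[symmetric]) auto
    then show ?thesis using ab Fr(6)[OF i(1) \<psi>(1)[OF ab(1)]] by metis
  qed
  then obtain t where t: "\<And>s. s \<in> S \<Longrightarrow> t s \<in> F"
      "\<And>s. s \<in> S \<Longrightarrow> \<exists>a\<in>D. \<exists>b\<in>D. \<psi> b \<noteq> \<zero> \<and> b \<otimes> s = a \<and> \<psi> a = \<psi> b \<otimes> t s"
    by metis
  have T: "finite (t ` S)" "t ` S \<subseteq> F" using S t by auto
  have Pc: "power_span (t ` S) n \<subseteq> carrier R" for n
    using T(2) Fr(1) by (intro power_span_carrier) auto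
  have Sc: "power_span S n \<subseteq> carrier R" for n using S(2) by (rule power_span_carrier)
  have nz: "x \<otimes> y \<noteq> \<zero>" if "x \<in> carrier R" "y \<in> carrier R" "x \<noteq> \<zero>" "y \<noteq> \<zero>" for x y
    using R.integral that by blast
  have claim: "\<exists>y\<in>power_span (t ` S) n. \<exists>a\<in>D. \<exists>b\<in>D. \<psi> b \<noteq> \<zero> \<and> b \<otimes> x = a \<and> \<psi> a = \<psi> b \<otimes> y"
    if "x \<in> power_span S n" for n x
    using that
  proof (induction rule: power_span_induct)
    case (const c)
    then have "c \<in> F" "c \<in> D" "\<one> \<in> F" "\<one> \<in> D" "c \<in> carrier R"
      using F(2) D(2) Fr(3) k_carrier by auto
    then have "\<psi> \<one> \<noteq> \<zero> \<and> \<one> \<otimes> c = c \<and> \<psi> c = \<psi> \<one> \<otimes> c" using \<psi>(4) by simp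
    then show ?case using power_span_const[OF const] \<open>c \<in> D\<close> \<open>\<one> \<in> D\<close> by blast
  next
    case (zero n)
    have "\<zero> \<in> F" "\<zero> \<in> D" "\<one> \<in> F" "\<one> \<in> D"
      using D(2) Fr(2,3) by auto
    then have "\<psi> \<one> \<noteq> \<zero> \<and> \<one> \<otimes> \<zero> = \<zero> \<and> \<psi> \<zero> = \<psi> \<one> \<otimes> \<zero>" using \<psi>(4) by simp
    then show ?case using power_span_zero \<open>\<zero> \<in> D\<close> \<open>\<one> \<in> D\<close> by blast
  next
    case (add n x x')
    then obtain y a b y' a' b' where
      1: "y \<in> power_span (t ` S) n" "a \<in> D" "b \<in> D" "\<psi> b \<noteq> \<zero>" "b \<otimes> x = a" "\<psi> a = \<psi> b \<otimes> y" and
      2: "y' \<in> power_span (t ` S) n" "a' \<in> D" "b' \<in> D" "\<psi> b' \<noteq> \<zero>" "b' \<otimes> x' = a'" "\<psi> a' = \<psi> b' \<otimes> y'"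
      by blast
    have c: "x \<in> carrier R" "x' \<in> carrier R" "y \<in> carrier R" "y' \<in> carrier R"
      using add Sc Pc 1 2 by auto
    note c = c Dc[OF 1(3)] Dc[OF 2(3)]
    have "b \<otimes> b' \<otimes> (x \<oplus> x') = b' \<otimes> (b \<otimes> x) \<oplus> b \<otimes> (b' \<otimes> x')"
      using c by algebra
    moreover have "\<psi> (b' \<otimes> a \<oplus> b \<otimes> a') = \<psi> b' \<otimes> (\<psi> b \<otimes> y) \<oplus> \<psi> b \<otimes> (\<psi> b' \<otimes> y')"
      using 1 2 \<psi> Dr(6) by simp
    moreover have "\<dots> = \<psi> b \<otimes> \<psi> b' \<otimes> (y \<oplus> y')" using c by algebra
    moreover have "\<psi> (b \<otimes> b') = \<psi> b \<otimes> \<psi> b'" using 1 2 \<psi> by simp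
    moreover have "\<psi> b \<otimes> \<psi> b' \<noteq> \<zero>" using nz c 1 2 by blast
    ultimately show ?case
      using power_span_add[OF 1(1) 2(1)] Dr(6,7) 1 2 by metis
  next
    case (mult s n x)
    then obtain y a b a' b' where
      1: "y \<in> power_span (t ` S) n" "a \<in> D" "b \<in> D" "\<psi> b \<noteq> \<zero>" "b \<otimes> x = a" "\<psi> a = \<psi> b \<otimes> y" and
      2: "a' \<in> D" "b' \<in> D" "\<psi> b' \<noteq> \<zero>" "b' \<otimes> s = a'" "\<psi> a' = \<psi> b' \<otimes> t s"
      using t(2) by meson
    have c: "x \<in> carrier R" "y \<in> carrier R" "s \<in> carrier R" "t s \<in> carrier R"
      using mult Sc Pc 1 2 S(2) t(1) Fr(1) by auto
    note c = c Dc[OF 1(3)] Dc[OF 2(2)]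
    have "b' \<otimes> b \<otimes> (s \<otimes> x) = (b' \<otimes> s) \<otimes> (b \<otimes> x)" using c by algebra
    moreover have "\<psi> (a' \<otimes> a) = (\<psi> b' \<otimes> t s) \<otimes> (\<psi> b \<otimes> y)" using 1 2 \<psi>(3) by simp
    moreover have "\<dots> = (\<psi> b' \<otimes> \<psi> b) \<otimes> (t s \<otimes> y)" using c by algebra
    moreover have "\<psi> (b' \<otimes> b) = \<psi> b' \<otimes> \<psi> b" using 1 2 \<psi>(3) by simp
    moreover have "\<psi> b' \<otimes> \<psi> b \<noteq> \<zero>" using nz c 1 2 by blast
    ultimately show ?case
      using power_span_mult[OF _ 1(1), of "t s"] mult(1) Dr(6) 1 2 by (metis imageI)
  qed
  have "power_span S n \<inter> F \<subseteq> power_span (t ` S) n" for n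
  proof
    fix x assume x: "x \<in> power_span S n \<inter> F"
    then obtain y a b where
      1: "y \<in> power_span (t ` S) n" "a \<in> D" "b \<in> D" "\<psi> b \<noteq> \<zero>" "b \<otimes> x = a" "\<psi> a = \<psi> b \<otimes> y"
      using claim by blast
    have "\<psi> a = \<psi> b \<otimes> x" using \<psi>(3)[OF 1(3), of x] \<psi>(4)[of x] x D(2) 1 by auto
    then have "\<psi> b \<otimes> x = \<psi> b \<otimes> y" using 1 by simp
    moreover have "x \<in> carrier R" "y \<in> carrier R" using x Fr(1) 1 Pc by auto
    ultimately have "x = y" using R.m_lcancel[OF 1(4) Dc(2)[OF 1(3)]] by simp
    then show "x \<in> power_span (t ` S) n" using 1 by simp
  qed
  then show ?thesis using T by blast
qed

lemma generate_field_fraction: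
  assumes D: "subring D R" and x: "x \<in> generate_field R D"
  shows "\<exists>a\<in>D. \<exists>b\<in>D. b \<noteq> \<zero> \<and> b \<otimes> x = a"
  using x
proof induction
  note Dr = subringE[OF D]
  have Dc: "x \<in> carrier R" if "x \<in> D" for x using that Dr(1) by auto
  have gc: "x \<in> carrier R" if "x \<in> generate_field R D" for x
    using R.generate_field_in_carrier[OF Dr(1)] that .
  have nz: "x \<otimes> y \<noteq> \<zero>" if "x \<in> carrier R" "y \<in> carrier R" "x \<noteq> \<zero>" "y \<noteq> \<zero>" for x y
    using R.integral that by blast
  {
    case one
    show ?case using Dr(3) by (intro bexI[of _ \<one>]) auto
  next
    case (incl h)
    then show ?case using Dr(3) Dc by (intro bexI[of _ h] bexI[of _ \<one>]) auto
  next
    case (a_inv h)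
    then show ?case using Dr(5) Dc gc R.r_minus by metis
  next
    case (m_inv h)
    then obtain a b where ab: "a \<in> D" "b \<in> D" "b \<noteq> \<zero>" "b \<otimes> h = a" by blast
    have hc: "h \<in> carrier R" "b \<in> carrier R" using gc m_inv Dc ab by auto
    have i: "inv h \<in> carrier R" "h \<otimes> inv h = \<one>"
      using R.field_Units hc m_inv(2) by auto
    have "a \<otimes> inv h = b" using ab(4) hc i by (metis R.m_assoc R.r_one)
    moreover have "a \<noteq> \<zero>" using nz hc ab m_inv by blast
    ultimately show ?case using ab by blast
  next
    case (eng_add x x')
    then obtain a b a' b' where
      1: "a \<in> D" "b \<in> D" "b \<noteq> \<zero>" "b \<otimes> x = a" and 2: "a' \<in> D" "b' \<in> D" "b' \<noteq> \<zero>" "b' \<otimes> x' = a'"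
      by blast
    have c: "x \<in> carrier R" "x' \<in> carrier R" "b \<in> carrier R" "b' \<in> carrier R"
      using gc eng_add Dc 1 2 by auto
    then have "b \<otimes> b' \<otimes> (x \<oplus> x') = b' \<otimes> (b \<otimes> x) \<oplus> b \<otimes> (b' \<otimes> x')" by algebra
    then show ?case using 1 2 Dr(6,7) nz c by metis
  next
    case (eng_mult x x')
    then obtain a b a' b' where
      1: "a \<in> D" "b \<in> D" "b \<noteq> \<zero>" "b \<otimes> x = a" and 2: "a' \<in> D" "b' \<in> D" "b' \<noteq> \<zero>" "b' \<otimes> x' = a'"
      by blast
    have c: "x \<in> carrier R" "x' \<in> carrier R" "b \<in> carrier R" "b' \<in> carrier R"
      using gc eng_mult Dc 1 2 by auto
    then have "b \<otimes> b' \<otimes> (x \<otimes> x') = (b \<otimes> x) \<otimes> (b' \<otimes> x')" by algebra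
    then show ?case using 1 2 Dr(6,7) nz c by metis
  }
qed

text \<open>
  Over a finite field there may be no point at which a given denominator does not vanish.  In that
  case \<open>T = F\<close> itself is finite.
\<close>

lemma controls_finite_field:
  assumes F: "subfield F R" "k \<subseteq> F" "finite F"
  shows "controls F E"
proof -
  note Fr = subringE[OF subfieldE(1)[OF F(1)]]
  have one: "\<one> \<in> power_span F n" for n
  proof (induction n)
    case 0
    then show ?case using power_span_const k_props(3) by blast
  next
    case (Suc n)
    then show ?case using power_span_mult[OF Fr(3)] by fastforce
  qed
  have "power_span S n \<inter> F \<subseteq> power_span F n" for S n
  proof (cases n)
    case 0
    then show ?thesis by (simp add: power_span_0)
  next
    case (Suc m)
    have "x \<in> power_span F n" if "x \<in> F" for x
      using power_span_mult[OF that one[of m]] that Fr(1) by (auto simp: Suc)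
    then show ?thesis by blast
  qed
  then show ?thesis using F(3) unfolding controls_def by blast
qed

text \<open>
  For infinite \<open>F\<close>, the finitely many denominators of the elements of \<open>S\<close> have only finitely many
  roots, so some \<open>a \<in> F\<close> is a root of none of them.  As \<open>h\<close> is transcendental, \<open>h \<mapsto> a\<close> defines a
  retraction of \<open>F[h]\<close> onto \<open>F\<close>.
\<close>

lemma controls_transcendental:
  assumes F: "subfield F R" "k \<subseteq> F" and h: "h \<in> carrier R" "(R.transcendental over F) h"
  shows "controls F (generate_field R (R.simple_extension F h))"
proof (cases "finite F")
  case True
  then show ?thesis using controls_finite_field F by blast
next
  case False
  define D where "D = R.simple_extension F h"
  note Fs = subfieldE(1)[OF F(1)]
  note Fr = subringE[OF Fs]
  have D: "subring D R" "F \<subseteq> D"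
    using R.simple_extension_is_subring[OF Fs h(1)] R.simple_extension_incl[OF Fr(1) h(1)]
    by (simp_all add: D_def)
  let ?P = "carrier (F [X]\<^bsub>R\<^esub>)"
  have Dimg: "D = (\<lambda>p. R.eval p h) ` ?P"
    unfolding D_def using R.simple_extension_as_eval_img[OF Fr(1) h(1)] .
  have DE: thesis if "x \<in> D" "\<And>p. p \<in> ?P \<Longrightarrow> x = R.eval p h \<Longrightarrow> thesis" for x thesis
    using that unfolding Dimg by (elim imageE)
  have inj: "inj_on (\<lambda>p. R.eval p h) ?P"
    using h(2) unfolding over_def R.transcendental_def .
  interpret H: ring_hom_ring "F [X]\<^bsub>R\<^esub>" R "\<lambda>p. R.eval p h"
    by (rule R.eval_ring_hom[OF Fs h(1)])
  show ?thesis
    unfolding controls_def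
  proof (intro allI impI)
    fix S assume S: "finite S \<and> S \<subseteq> generate_field R (R.simple_extension F h)"
    have "\<exists>p\<in>?P. \<exists>q\<in>?P. R.eval q h \<noteq> \<zero> \<and> R.eval q h \<otimes> s = R.eval p h" if "s \<in> S" for s
      using generate_field_fraction[OF D(1), of s] that S unfolding D_def[symmetric] unfolding Dimg by auto
    then obtain p q where pq: "\<And>s. s \<in> S \<Longrightarrow> p s \<in> ?P" "\<And>s. s \<in> S \<Longrightarrow> q s \<in> ?P"
      "\<And>s. s \<in> S \<Longrightarrow> R.eval (q s) h \<noteq> \<zero>" "\<And>s. s \<in> S \<Longrightarrow> R.eval (q s) h \<otimes> s = R.eval (p s) h"
      by metis
    have "finite (\<Union>s\<in>S. {x. R.is_root (q s) x})"
      using S pq(2) R.finite_number_of_roots R.carrier_polynomial_shell[OF Fs] by blast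
    then have "\<not> F \<subseteq> (\<Union>s\<in>S. {x. R.is_root (q s) x})"
      using False finite_subset by blast
    then obtain a where a: "a \<in> F" "\<And>s. s \<in> S \<Longrightarrow> \<not> R.is_root (q s) a"
      by blast
    have ac: "a \<in> carrier R" using a Fr(1) by blast
    have qa: "R.eval (q s) a \<noteq> \<zero>" if "s \<in> S" for s
      using a(2)[OF that] pq(3)[OF that] ac unfolding R.is_root_def by auto
    interpret A: ring_hom_ring "F [X]\<^bsub>R\<^esub>" R "\<lambda>p. R.eval p a"
      by (rule R.eval_ring_hom[OF Fs ac])
    define \<psi> where "\<psi> x = R.eval (the_inv_into ?P (\<lambda>p. R.eval p h) x) a" for x
    have \<psi>: "\<psi> (R.eval p h) = R.eval p a" if "p \<in> ?P" for p
      unfolding \<psi>_def using the_inv_into_f_f[OF inj that] by simp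
    have "\<exists>T. finite T \<and> T \<subseteq> F \<and> (\<forall>n. power_span S n \<inter> F \<subseteq> power_span T n)"
    proof (rule controls_by_specialization[OF F D])
      show "\<psi> x \<in> F" if "x \<in> D" for x
      proof -
        obtain p where p: "p \<in> ?P" "x = R.eval p h" using DE[OF \<open>x \<in> D\<close>] .
        have "R.eval p a \<in> R.simple_extension F a"
          using R.simple_extension_as_eval_img[OF Fr(1) ac] p(1) by blast
        then have "R.eval p a \<in> F"
          using R.simple_extension_subring_incl[OF Fs subset_refl a(1)] by blast
        then show ?thesis unfolding p(2) \<psi>[OF p(1)] .
      qed
      show "\<psi> (x \<oplus> y) = \<psi> x \<oplus> \<psi> y" if "x \<in> D" "y \<in> D" for x y
      proof -
        obtain p q where p: "p \<in> ?P" "x = R.eval p h" "q \<in> ?P" "y = R.eval q h"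
          using DE[OF \<open>x \<in> D\<close>] DE[OF \<open>y \<in> D\<close>] by metis
        have pq: "p \<oplus>\<^bsub>F [X]\<^bsub>R\<^esub>\<^esub> q \<in> ?P" using p(1,3) by (rule H.R.a_closed)
        have "\<psi> (x \<oplus> y) = R.eval (p \<oplus>\<^bsub>F [X]\<^bsub>R\<^esub>\<^esub> q) a"
          unfolding p(2,4) H.hom_add[OF p(1,3), symmetric] by (rule \<psi>[OF pq])
        then show ?thesis
          unfolding A.hom_add[OF p(1,3)] p(2,4) \<psi>[OF p(1)] \<psi>[OF p(3)] .
      qed
      show "\<psi> (x \<otimes> y) = \<psi> x \<otimes> \<psi> y" if "x \<in> D" "y \<in> D" for x y
      proof -
        obtain p q where p: "p \<in> ?P" "x = R.eval p h" "q \<in> ?P" "y = R.eval q h"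
          using DE[OF \<open>x \<in> D\<close>] DE[OF \<open>y \<in> D\<close>] by metis
        have pq: "p \<otimes>\<^bsub>F [X]\<^bsub>R\<^esub>\<^esub> q \<in> ?P" using p(1,3) by (rule H.R.m_closed)
        have "\<psi> (x \<otimes> y) = R.eval (p \<otimes>\<^bsub>F [X]\<^bsub>R\<^esub>\<^esub> q) a"
          unfolding p(2,4) H.hom_mult[OF p(1,3), symmetric] by (rule \<psi>[OF pq])
        then show ?thesis
          unfolding A.hom_mult[OF p(1,3)] p(2,4) \<psi>[OF p(1)] \<psi>[OF p(3)] .
      qed
      show "\<psi> c = c" if "c \<in> F" for c
      proof (cases "c = \<zero>")
        case True
        then show ?thesis using \<psi>[of "\<zero>\<^bsub>F [X]\<^bsub>R\<^esub>\<^esub>"] by simp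
      next
        case False
        then have "[c] \<in> ?P" using that unfolding univ_poly_def polynomial_def by auto
        then show ?thesis using \<psi>[of "[c]"] that Fr(1) by auto
      qed
      show "finite S" using S by blast
      show "S \<subseteq> carrier R"
        using S R.generate_field_incl[OF subringE(1)[OF D(1)]] unfolding D_def by blast
      show "\<exists>a\<in>D. \<exists>b\<in>D. \<psi> b \<noteq> \<zero> \<and> b \<otimes> s = a" if "s \<in> S" for s
        using pq[OF that] \<psi>[OF pq(2)[OF that]] qa[OF that]
        by (intro bexI[of _ "R.eval (p s) h"] bexI[of _ "R.eval (q s) h"]) (auto simp: Dimg)
    qed
    then show "\<exists>T. finite T \<and> T \<subseteq> F \<and> (\<forall>n. power_span S n \<inter> F \<subseteq> power_span T n)" .
  qed
qed

text \<open>
  The elements of \<open>H\<close> are adjoined one by one, and in each step a field is reached by adjoining the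
  element if it is algebraic over the field reached before, and by passing to the fraction field of
  the ring obtained if it is transcendental.
\<close>

lemma controls_finitely_generated:
  assumes F: "subfield F R" "k \<subseteq> F" and H: "finite H" "H \<subseteq> carrier R"
  obtains E where "subfield E R" "F \<subseteq> E" "H \<subseteq> E" "controls F E"
proof -
  have "\<exists>E. subfield E R \<and> F \<subseteq> E \<and> H \<subseteq> E \<and> controls F E"
    using H
  proof (induction H)
    case empty
    then show ?case using F controls_refl by blast
  next
    case (insert h H)
    then obtain E where E: "subfield E R" "F \<subseteq> E" "H \<subseteq> E" "controls F E" by auto
    have h: "h \<in> carrier R" using insert by simp
    note Es = subfieldE(1)[OF E(1)]
    let ?D = "R.simple_extension E h"
    have kE: "k \<subseteq> E" using F(2) E(2) by blast
    have D: "subring ?D R" "E \<subseteq> ?D" "h \<in> ?D"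
      using R.simple_extension_is_subring[OF Es h] R.simple_extension_incl[OF _ h, of E]
        R.simple_extension_mem[OF Es h] subringE(1)[OF Es] by auto
    show ?case
    proof (cases "(R.transcendental over E) h")
      case True
      have "controls E (generate_field R ?D)"
        using controls_transcendental[OF E(1) kE h True] .
      moreover have "subfield (generate_field R ?D) R" "?D \<subseteq> generate_field R ?D"
        using R.generate_fieldE(1,2)[OF subringE(1)[OF D(1)] refl] by auto
      ultimately show ?thesis using controls_trans[OF E(2,4)] E D by blast
    next
      case False
      have "R.finite_dimension E ?D" "subfield ?D R"
        using False R.finite_dimension_simple_extension[OF E(1) h]
          R.simple_extension_is_subfield[OF E(1) h] by (auto simp: over_def)
      then show ?thesis
        using controls_finite_dimension[OF E(1) kE D(1,2)] controls_trans[OF E(2,4)] E D by blast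
    qed
  qed
  then show ?thesis using that by blast
qed

theorem power_span_inter_subfield:
  assumes "subfield F R" "k \<subseteq> F" "finite S" "S \<subseteq> carrier R"
  obtains T where "finite T" "T \<subseteq> F" "\<And>n. power_span S n \<inter> F \<subseteq> power_span T n"
proof -
  obtain E where E: "F \<subseteq> E" "S \<subseteq> E" "controls F E"
    using controls_finitely_generated[OF assms] by metis
  have "\<exists>T. finite T \<and> T \<subseteq> F \<and> (\<forall>n. power_span S n \<inter> F \<subseteq> power_span T n)"
    using E(3) E(2) assms(3) unfolding controls_def by simp
  with that show ?thesis by (elim exE conjE) simp
qed

section \<open>Passing between weights and numbers of factors\<close>

lemma power_span_pad:
  assumes "\<one> \<in> S" "S \<subseteq> carrier R"
  shows "x \<in> power_span S n \<Longrightarrow> x \<in> power_span S (n + j)"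
proof (induction j)
  case (Suc j)
  then have "\<one> \<otimes> x \<in> power_span S (Suc (n + j))" using power_span_mult[OF assms(1)] by blast
  moreover have "x \<in> carrier R" using power_span_carrier[OF assms(2)] Suc.prems by blast
  ultimately show ?case by simp
qed simp

text \<open>
  The factors of a monomial of weight \<open>d n\<close> may have weights that are not multiples of \<open>d\<close>; the
  exponent \<open>m div d\<close> extends the statement to all weights without a \<open>d\<close>-th root of \<open>\<gamma>\<close>.  If a
  factor of weight \<open>m\<close> is added, the exponent grows by some \<open>j \<le> m\<close>, which depends on the weight
  reached before; hence \<open>S\<close> contains \<open>h \<otimes> \<gamma> [^] j\<close> for all of these \<open>j\<close>.  The element \<open>1\<close> fills up
  the number of factors to the weight.
\<close>

lemma weighted_span_dehomogenize:
  assumes H: "weighted_elements H" and \<gamma>: "\<gamma> \<in> carrier R" and "0 < d"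
  obtains S where "finite S" "S \<subseteq> carrier R"
    "\<And>m f. f \<in> weighted_span R k H m \<Longrightarrow> f \<otimes> \<gamma> [^] (m div d) \<in> power_span S m"
proof -
  define S where "S = insert \<one> (\<Union>(h, m)\<in>H. (\<lambda>j. h \<otimes> \<gamma> [^] j) ` {..m})"
  have "finite S" using H by (auto simp: S_def weighted_elements_def)
  moreover have Sc: "S \<subseteq> carrier R"
    using H \<gamma> by (auto simp: S_def weighted_elements_def)
  moreover have "f \<otimes> \<gamma> [^] (m div d) \<in> power_span S m" if "weighted_combination R k H m f" for m f
    using that
  proof (induction)
    case (const c)
    then show ?case using power_span_const k_carrier[OF const] by simp
  next
    case (zero n)
    then show ?case using \<gamma> power_span_zero by simp
  next
    case (add n x y)
    then have "x \<in> carrier R" "y \<in> carrier R"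
      using weighted_span_carrier[OF H] by (auto simp: weighted_span_def)
    then show ?case using add \<gamma> power_span_add by (simp add: R.l_distr)
  next
    case (mult h m n x)
    have c: "x \<in> carrier R" "h \<in> carrier R" and m: "0 < m"
      using weighted_span_carrier[OF H] mult H by (auto simp: weighted_span_def weighted_elements_def)
    have "(m + n) div d \<le> (n + m * d) div d" using \<open>0 < d\<close> by (intro div_le_mono) simp
    also have "\<dots> = m + n div d" using \<open>0 < d\<close> by simp
    finally have "(m + n) div d \<le> m + n div d" .
    moreover have "n div d \<le> (m + n) div d" by (intro div_le_mono) simp
    ultimately obtain j where j: "(m + n) div d = j + n div d" "j \<le> m"
      by (metis add.commute add_le_cancel_right le_iff_add)
    have "h \<otimes> \<gamma> [^] j \<in> S"
      unfolding S_def using mult(1) j(2) by auto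
    from power_span_mult[OF this mult.IH]
    have "h \<otimes> \<gamma> [^] j \<otimes> (x \<otimes> \<gamma> [^] (n div d)) \<in> power_span S (Suc n)" .
    moreover have "h \<otimes> \<gamma> [^] j \<otimes> (x \<otimes> \<gamma> [^] (n div d)) = h \<otimes> x \<otimes> \<gamma> [^] ((m + n) div d)"
      using c \<gamma> unfolding j(1) by (simp add: R.nat_pow_mult[symmetric] R.m_ac)
    ultimately have "h \<otimes> x \<otimes> \<gamma> [^] ((m + n) div d) \<in> power_span S (Suc n)" by simp
    then have "h \<otimes> x \<otimes> \<gamma> [^] ((m + n) div d) \<in> power_span S (Suc n + (m - 1))"
      by (intro power_span_pad[OF _ Sc]) (auto simp: S_def)
    moreover have "Suc n + (m - 1) = m + n" using m by simp
    ultimately show ?case by metis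
  qed
  ultimately show ?thesis using that by (auto simp: weighted_span_def)
qed

primrec products :: "'a set \<Rightarrow> nat \<Rightarrow> 'a set" where
  "products S 0 = {\<one>}"
| "products S (Suc r) = (\<lambda>(p, s). p \<otimes> s) ` (products S r \<times> S)"

lemma finite_products: "finite S \<Longrightarrow> finite (products S r)"
  by (induction r) auto

lemma products_subset:
  assumes "subring F R" "S \<subseteq> F"
  shows "products S r \<subseteq> F"
  using assms(2) subringE(3,6)[OF assms(1)] by (induction r) auto

text \<open>
  The factors are collected in blocks of length \<open>d\<close>, and each complete block is multiplied by one
  factor \<open>g\<close>.  For the induction, \<open>p\<close> is the current incomplete block, consisting of \<open>r < d\<close> factors.
\<close>

lemma power_span_homogenize:
  assumes S: "S \<subseteq> carrier R" and g: "g \<in> carrier R" and "0 < d"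
    and x: "x \<in> power_span S (d * n)"
  shows "g [^] n \<otimes> x \<in> weighted_span R k ((\<lambda>p. (g \<otimes> p, d)) ` products S d) (d * n)"
proof -
  define H where "H = (\<lambda>p. (g \<otimes> p, d)) ` products S d"
  have pc: "products S r \<subseteq> carrier R" for r
    using products_subset[OF R.carrier_is_subring S] .
  have "\<forall>r p n. r < d \<longrightarrow> p \<in> products S r \<longrightarrow> m + r = d * n \<longrightarrow>
      g [^] n \<otimes> (p \<otimes> x) \<in> weighted_span R k H (d * n)" if "x \<in> power_span S m" for m x
    using that
  proof (induction rule: power_span_induct)
    case (const c)
    show ?case
    proof (intro allI impI)
      fix r p n assume *: "r < d" "p \<in> products S r" "0 + r = d * n"
      then have "n = 0" by (cases n) auto
      then show "g [^] n \<otimes> (p \<otimes> c) \<in> weighted_span R k H (d * n)"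
        using * const k_carrier[OF const]
        by (auto simp: weighted_span_def intro: weighted_combination.const)
    qed
  next
    case (zero m)
    have "g [^] n \<otimes> (p \<otimes> \<zero>) = \<zero>" if "p \<in> products S r" for r p and n :: nat
      using that pc[of r] g by auto
    then show ?case using weighted_span_zero by simp
  next
    case (add m x y)
    have c: "x \<in> carrier R" "y \<in> carrier R" using add.hyps power_span_carrier[OF S] by blast+
    show ?case
    proof (intro allI impI)
      fix r p n assume *: "r < d" "p \<in> products S r" "m + r = d * n"
      have "p \<in> carrier R" using * pc by auto
      then have "g [^] n \<otimes> (p \<otimes> (x \<oplus> y)) = g [^] n \<otimes> (p \<otimes> x) \<oplus> g [^] n \<otimes> (p \<otimes> y)"
        using c g by (simp add: R.r_distr)
      then show "g [^] n \<otimes> (p \<otimes> (x \<oplus> y)) \<in> weighted_span R k H (d * n)"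
        using add * weighted_span_add by simp
    qed
  next
    case (mult s m x)
    have c: "x \<in> carrier R" "s \<in> carrier R" using mult.hyps power_span_carrier[OF S] S by blast+
    show ?case
    proof (intro allI impI)
      fix r p n assume *: "r < d" "p \<in> products S r" "Suc m + r = d * n"
      have p: "p \<in> carrier R" using * pc by auto
      have ps: "p \<otimes> s \<in> products S (Suc r)" using * mult(1) by force
      show "g [^] n \<otimes> (p \<otimes> (s \<otimes> x)) \<in> weighted_span R k H (d * n)"
      proof (cases "Suc r < d")
        case True
        then have "g [^] n \<otimes> (p \<otimes> s \<otimes> x) \<in> weighted_span R k H (d * n)"
          using mult.IH ps * by auto
        then show ?thesis using c p by (simp add: R.m_assoc)
      next
        case False
        then have r: "Suc r = d" using * by simp
        obtain n' where n': "n = Suc n'" using * by (cases n) auto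
        have "m = d * n'" using * r n' by simp
        then have "g [^] n' \<otimes> (\<one> \<otimes> x) \<in> weighted_span R k H (d * n')"
          using mult.IH \<open>0 < d\<close> by auto
        moreover have "(g \<otimes> (p \<otimes> s), d) \<in> H" using ps r by (simp add: H_def)
        ultimately have "g \<otimes> (p \<otimes> s) \<otimes> (g [^] n' \<otimes> (\<one> \<otimes> x)) \<in> weighted_span R k H (d + d * n')"
          unfolding weighted_span_def by (auto intro: weighted_combination.mult)
        moreover have "g \<otimes> (p \<otimes> s) \<otimes> (g [^] n' \<otimes> (\<one> \<otimes> x)) = g [^] n \<otimes> (p \<otimes> (s \<otimes> x))"
          using c p g by (simp add: n' R.m_ac)
        ultimately show ?thesis by (simp add: n')
      qed
    qed
  qed
  from this[OF x, rule_format, of 0 \<one> n] show ?thesis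
    using \<open>0 < d\<close> x power_span_carrier[OF S, of "d * n"] g by (auto simp: H_def)
qed

text \<open>
  All monomials have a weight \<open>d q\<close> and the form \<open>g [^] q\<close> times an element of \<open>F\<close>.  Hence fractions
  of elements of equal weight lie in \<open>F\<close>.
\<close>

lemma weighted_span_multiple:
  assumes F: "subring F R" "k \<subseteq> F" and S: "S \<subseteq> F" and g: "g \<in> carrier R" and "0 < d"
    and x: "x \<in> weighted_span R k ((\<lambda>p. (g \<otimes> p, d)) ` products S d) m"
  shows "\<exists>y\<in>F. x = g [^] (m div d) \<otimes> y"
proof -
  note Fr = subringE[OF F(1)]
  have Fc: "y \<in> carrier R" if "y \<in> F" for y using that Fr(1) by auto
  have "weighted_combination R k ((\<lambda>p. (g \<otimes> p, d)) ` products S d) m x"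
    using x by (simp add: weighted_span_def)
  then show ?thesis
  proof (induction)
    case (const c)
    then show ?case using F(2) k_carrier[OF const] by (intro bexI[of _ c]) auto
  next
    case (zero n)
    then show ?case using Fr(2) g by (intro bexI[of _ \<zero>]) auto
  next
    case (add n x x')
    then obtain y y' where "y \<in> F" "y' \<in> F" "x = g [^] (n div d) \<otimes> y" "x' = g [^] (n div d) \<otimes> y'"
      by blast
    then show ?case using Fr(7) g Fc by (intro bexI[of _ "y \<oplus> y'"]) (auto simp: R.r_distr)
  next
    case (mult h m n x)
    then obtain y p where y: "y \<in> F" "x = g [^] (n div d) \<otimes> y"
        and p: "p \<in> products S d" "h = g \<otimes> p" "m = d" by blast
    have pF: "p \<in> F" using products_subset[OF F(1) S] p by blast
    have "(m + n) div d = Suc (n div d)" using \<open>0 < d\<close> p by simp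
    then show ?case using Fr(6)[OF pF y(1)] g Fc[OF pF] Fc[OF y(1)] p y
      by (intro bexI[of _ "p \<otimes> y"]) (auto simp: R.m_ac)
  qed
qed

section \<open>The field of rational functions and the enlarged series\<close>

lemma graded_linear_series_mult:
  assumes V: "graded_linear_series R k V" and "x \<in> V m" "y \<in> V n"
  shows "x \<otimes> y \<in> V (m + n)"
proof -
  interpret P: UP_cring R "UP R" by unfold_locales
  note c = graded_linear_series_carrier[OF V]
  have "subring (graded_sum R V) (UP R)" using V by (simp add: graded_linear_series_def)
  from subringE(6)[OF this c(2)[OF assms(2)] c(2)[OF assms(3)]]
  have "up_ring.monom (UP R) (x \<otimes> y) (m + n) \<in> graded_sum R V"
    unfolding P.monom_mult[OF c(1)[OF assms(2)] c(1)[OF assms(3)]] .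
  then have "up_ring.coeff (UP R) (up_ring.monom (UP R) (x \<otimes> y) (m + n)) (m + n) \<in> V (m + n)"
    by (simp add: graded_sum_def)
  moreover have "x \<otimes> y \<in> carrier R" using c(1) assms by simp
  ultimately show ?thesis using P.coeff_monom by simp
qed

lemma graded_linear_series_pow:
  assumes V: "graded_linear_series R k V" and x: "x \<in> V m"
  shows "x [^] (q::nat) \<in> V (q * m)"
proof (induction q)
  case 0
  then show ?case using V k_props(3) by (simp add: graded_linear_series_def)
next
  case (Suc q)
  then show ?case using graded_linear_series_mult[OF V Suc x] by (simp add: add.commute)
qed

lemma rational_function_field_subfield:
  assumes V: "graded_linear_series R k V"
  shows "subfield (rational_function_field R k V) R" "k \<subseteq> rational_function_field R k V"
    "\<lbrakk>1 \<le> n; f \<in> V n; g \<in> V n; f \<noteq> \<zero>; g \<noteq> \<zero>\<rbrakk> \<Longrightarrow> f \<otimes> inv g \<in> rational_function_field R k V"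
proof -
  define Q where "Q = k \<union> {f \<otimes> inv g | f g. f \<noteq> \<zero> \<and> g \<noteq> \<zero> \<and> (\<exists>n\<ge>1. {f, g} \<subseteq> V n)}"
  have r: "rational_function_field R k V = generate_field R Q"
    by (simp add: rational_function_field_def Q_def)
  have ci: "f \<otimes> inv g \<in> carrier R" if "f \<in> V n" "g \<in> V n" "g \<noteq> \<zero>" for f g n
    using graded_linear_series_carrier(1)[OF V] that R.field_Units by auto
  have Q: "Q \<subseteq> carrier R" using ci k_carrier by (auto simp: Q_def)
  show "subfield (rational_function_field R k V) R" "k \<subseteq> rational_function_field R k V"
    unfolding r using R.generate_fieldE(1,2)[OF Q refl] by (auto simp: Q_def)
  show "f \<otimes> inv g \<in> rational_function_field R k V"
    if "1 \<le> n" "f \<in> V n" "g \<in> V n" "f \<noteq> \<zero>" "g \<noteq> \<zero>"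
    unfolding r using that by (intro generate_field.incl) (auto simp: Q_def)
qed

lemma rational_function_field_eqI:
  assumes V: "graded_linear_series R k V" and W: "graded_linear_series R k W"
    and VW: "contained_in V W"
    and frac: "\<And>n f g. \<lbrakk>1 \<le> n; f \<in> W n; g \<in> W n; f \<noteq> \<zero>; g \<noteq> \<zero>\<rbrakk>
      \<Longrightarrow> f \<otimes> inv g \<in> rational_function_field R k V"
  shows "rational_function_field R k V = rational_function_field R k W"
proof
  note rV = rational_function_field_subfield[OF V]
  note rW = rational_function_field_subfield[OF W]
  have c: "rational_function_field R k V \<subseteq> carrier R" "rational_function_field R k W \<subseteq> carrier R"
    using subfieldE(3) rV(1) rW(1) by blast+
  have "k \<union> {f \<otimes> inv g | f g. f \<noteq> \<zero> \<and> g \<noteq> \<zero> \<and> (\<exists>n\<ge>1. {f, g} \<subseteq> V n)}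
      \<subseteq> rational_function_field R k W"
    using rW(2,3) VW by (auto simp: contained_in_def) blast
  then show "rational_function_field R k V \<subseteq> rational_function_field R k W"
    unfolding rational_function_field_def[of R k V]
    using c(2) by (intro R.generate_field_min_subfield1[OF _ rW(1)]) (rule subset_trans)
  have "k \<union> {f \<otimes> inv g | f g. f \<noteq> \<zero> \<and> g \<noteq> \<zero> \<and> (\<exists>n\<ge>1. {f, g} \<subseteq> W n)}
      \<subseteq> rational_function_field R k V"
    using rV(2) frac by auto
  then show "rational_function_field R k W \<subseteq> rational_function_field R k V"
    unfolding rational_function_field_def[of R k W]
    using c(1) by (intro R.generate_field_min_subfield1[OF _ rV(1)]) (rule subset_trans)
qed

text \<open>
  Take \<open>d\<close> minimal among the positive differences of degrees \<open>b + d\<close> and \<open>b\<close> of nonzero homogeneous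
  elements \<open>u\<close> and \<open>v\<close>, and \<open>g = u / v\<close>.  For a nonzero \<open>f\<close> of degree \<open>m\<close>, the elements
  \<open>f v\<^sup>q\<close> and \<open>u\<^sup>q\<close> with \<open>q = m div d\<close> have degrees differing by \<open>m mod d\<close>.  By minimality this
  difference is zero, and then \<open>f / g\<^sup>q = f v\<^sup>q / u\<^sup>q\<close> is a quotient of elements of equal degree.
\<close>

lemma exists_homogeneous_unit:
  assumes V: "graded_linear_series R k V" and ne: "1 \<le> n" "w \<in> V n" "w \<noteq> \<zero>"
  obtains d g \<gamma> where "0 < d" "g \<in> carrier R" "\<gamma> \<in> carrier R" "g \<otimes> \<gamma> = \<one>"
    "\<And>m f. f \<in> V m \<Longrightarrow> f \<noteq> \<zero> \<Longrightarrow>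
      d dvd m \<and> f \<otimes> \<gamma> [^] (m div d) \<in> rational_function_field R k V"
proof -
  note c = graded_linear_series_carrier(1)[OF V]
  note rV = rational_function_field_subfield[OF V]
  have V0: "V 0 = k" using V by (simp add: graded_linear_series_def)
  have nz: "x \<otimes> y \<noteq> \<zero>" if "x \<in> carrier R" "y \<in> carrier R" "x \<noteq> \<zero>" "y \<noteq> \<zero>" for x y
    using R.integral that by blast
  have pnz: "x [^] (q::nat) \<noteq> \<zero>" if "x \<in> carrier R" "x \<noteq> \<zero>" for x q
    using that by (induction q) (simp_all add: nz)
  define diff where "diff e \<longleftrightarrow> 0 < e \<and> (\<exists>b u v. u \<in> V (b + e) \<and> v \<in> V b \<and> u \<noteq> \<zero> \<and> v \<noteq> \<zero>)" for e
  \<comment> \<open>\<open>w\<close> is compared with \<open>1\<close>, of degree \<open>0\<close>\<close>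
  have "diff n"
    unfolding diff_def using ne V0 k_props(3)
    by (intro conjI exI[of _ 0] exI[of _ w] exI[of _ \<one>]) auto
  define d where "d = (LEAST e. diff e)"
  have "diff d" unfolding d_def using \<open>diff n\<close> by (rule LeastI)
  then obtain b u v where d: "0 < d" and u: "u \<in> V (b + d)" "u \<noteq> \<zero>" and v: "v \<in> V b" "v \<noteq> \<zero>"
    by (auto simp: diff_def)
  have uc: "u \<in> carrier R" and vc: "v \<in> carrier R" using c u v by auto
  have iu: "inv u \<in> carrier R" "u \<otimes> inv u = \<one>" and iv: "inv v \<in> carrier R" "v \<otimes> inv v = \<one>"
    using R.field_Units uc vc u v by auto
  define g where "g = u \<otimes> inv v"
  define \<gamma> where "\<gamma> = v \<otimes> inv u"
  have gc: "g \<in> carrier R" "\<gamma> \<in> carrier R" using uc vc iu iv by (auto simp: g_def \<gamma>_def)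
  have "g \<otimes> \<gamma> = (u \<otimes> inv u) \<otimes> (v \<otimes> inv v)"
    using uc vc iu(1) iv(1) by (simp add: g_def \<gamma>_def R.m_ac)
  then have g\<gamma>: "g \<otimes> \<gamma> = \<one>" using iu iv by simp
  have "d dvd m \<and> f \<otimes> \<gamma> [^] (m div d) \<in> rational_function_field R k V"
    if f: "f \<in> V m" "f \<noteq> \<zero>" for m f
  proof -
    define q where "q = m div d"
    have fc: "f \<in> carrier R" using c f by blast
    have 1: "f \<otimes> v [^] q \<in> V (m + q * b)" "f \<otimes> v [^] q \<noteq> \<zero>"
      using graded_linear_series_mult[OF V f(1) graded_linear_series_pow[OF V v(1)]]
        nz[OF fc _ f(2) pnz[OF vc v(2)]] vc by auto
    have 2: "u [^] q \<in> V (q * (b + d))" "u [^] q \<noteq> \<zero>"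
      using graded_linear_series_pow[OF V u(1)] pnz[OF uc u(2)] by auto
    have e: "m + q * b = q * (b + d) + m mod d"
      using div_mult_mod_eq[of m d] by (simp add: q_def algebra_simps)
    have "m mod d = 0"
    proof (rule ccontr)
      assume "m mod d \<noteq> 0"
      then have "diff (m mod d)" unfolding diff_def using 1 2 unfolding e by blast
      then have "d \<le> m mod d" unfolding d_def by (rule Least_le)
      then show False using mod_less_divisor[OF d, of m] by simp
    qed
    then have e: "m + q * b = q * (b + d)" and dm: "d dvd m" using e by auto
    show ?thesis
    proof (cases "q = 0")
      case True
      then have "m = 0" using dm d unfolding q_def by auto
      then show ?thesis using f(1) V0 rV(2) fc by auto
    next
      case False
      then have "1 \<le> q * (b + d)" using d by auto
      then have F: "f \<otimes> v [^] q \<otimes> inv (u [^] q) \<in> rational_function_field R k V"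
        using rV(3)[OF _ _ 2(1) 1(2) 2(2)] 1(1) unfolding e by blast
      have uq: "u [^] q \<in> carrier R" "inv (u [^] q) \<in> carrier R" "inv (u [^] q) \<otimes> u [^] q = \<one>"
        using R.field_Units uc 2(2) by auto
      have "u [^] q \<otimes> inv u [^] q = \<one>"
        using R.nat_pow_distrib[OF uc iu(1), of q] iu by simp
      then have "inv u [^] q = inv (u [^] q)"
        using uq iu(1) by (intro R.inv_char[symmetric]) (auto simp: R.m_comm)
      then have "\<gamma> [^] q = v [^] q \<otimes> inv (u [^] q)"
        unfolding \<gamma>_def using R.nat_pow_distrib[OF vc iu(1), of q] by simp
      then have "f \<otimes> \<gamma> [^] q = f \<otimes> v [^] q \<otimes> inv (u [^] q)"
        using fc vc uq by (simp add: R.m_assoc)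
      then show ?thesis using F dm by (simp add: q_def)
    qed
  qed
  then show ?thesis using that d gc g\<gamma> by blast
qed

text \<open>
  If all components of positive degree vanish, there is no homogeneous fraction to start from, and
  the series generated by no elements at all is \<open>V\<^sub>\<bullet>\<close> itself.
\<close>

lemma subfinite_type_imp_finite_type_hull:
  assumes V: "graded_linear_series R k V" and sub: "subfinite_type R k V"
  shows "\<exists>W. graded_linear_series R k W \<and> finite_type R k W \<and> contained_in V W \<and>
    rational_function_field R k V = rational_function_field R k W"
proof (cases "\<exists>n w. 1 \<le> n \<and> w \<in> V n \<and> w \<noteq> \<zero>")
  case False
  have H: "weighted_elements {}" by (simp add: weighted_elements_def)
  let ?W = "weighted_span R k {}"
  have "n = 0 \<or> x = \<zero>" if "weighted_combination R k {} n x" for n x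
    using that by induction auto
  then have W0: "x = \<zero>" if "x \<in> ?W n" "1 \<le> n" for n x
    using that by (auto simp: weighted_span_def)
  note gls = graded_linear_series_weighted_span[OF H]
  have "V n \<subseteq> ?W n" for n
  proof (cases "n = 0")
    case True
    then show ?thesis using V gls by (auto simp: graded_linear_series_def)
  next
    case n: False
    then show ?thesis using False weighted_span_zero[of "{}" n] by (cases n) fastforce+
  qed
  then have "contained_in V ?W" by (simp add: contained_in_def)
  then show ?thesis
    using gls finite_type_weighted_span[OF H]
      rational_function_field_eqI[OF V gls] W0 by blast
next
  case True
  then obtain n w where "1 \<le> n" "w \<in> V n" "w \<noteq> \<zero>" by blast
  then obtain d g \<gamma> where d: "0 < d" and g: "g \<in> carrier R" "\<gamma> \<in> carrier R" "g \<otimes> \<gamma> = \<one>"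
    and dg: "\<And>m f. f \<in> V m \<Longrightarrow> f \<noteq> \<zero> \<Longrightarrow>
      d dvd m \<and> f \<otimes> \<gamma> [^] (m div d) \<in> rational_function_field R k V"
    using exists_homogeneous_unit[OF V] by metis
  let ?F = "rational_function_field R k V"
  note rV = rational_function_field_subfield[OF V]
  note Fs = subfieldE(1)[OF rV(1)]
  have Fc: "?F \<subseteq> carrier R" using subringE(1)[OF Fs] .
  obtain U where U: "graded_linear_series R k U" "finite_type R k U" "contained_in V U"
    using sub unfolding subfinite_type_def by blast
  obtain H where H: "weighted_elements H" "\<And>n. U n \<subseteq> weighted_span R k H n"
    using finite_type_contained_in_weighted_span[OF U(1,2)] by metis
  obtain S where S: "finite S" "S \<subseteq> carrier R"
    "\<And>m f. f \<in> weighted_span R k H m \<Longrightarrow> f \<otimes> \<gamma> [^] (m div d) \<in> power_span S m"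
    using weighted_span_dehomogenize[OF H(1) g(2) d] by metis
  obtain T where T: "finite T" "T \<subseteq> ?F" "\<And>n. power_span S n \<inter> ?F \<subseteq> power_span T n"
    using power_span_inter_subfield[OF rV(1,2) S(1,2)] by metis
  have Tc: "T \<subseteq> carrier R" using T Fc by blast
  define G where "G = (\<lambda>p. (g \<otimes> p, d)) ` products T d"
  define W where "W = weighted_span R k G"
  have G: "weighted_elements G"
    using finite_products[OF T(1)] products_subset[OF R.carrier_is_subring Tc] g(1) d
    by (auto simp: weighted_elements_def G_def)
  have W: "graded_linear_series R k W" "finite_type R k W"
    unfolding W_def using graded_linear_series_weighted_span[OF G] finite_type_weighted_span[OF G] by auto
  have VW: "contained_in V W"
    unfolding contained_in_def
  proof (intro allI subsetI)
    fix m f assume f: "f \<in> V m"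
    show "f \<in> W m"
    proof (cases "f = \<zero>")
      case True
      then show ?thesis by (simp add: W_def weighted_span_zero)
    next
      case False
      define q where "q = m div d"
      have m: "m = d * q" and fq: "f \<otimes> \<gamma> [^] q \<in> ?F"
        using dg[OF f False] by (auto simp: q_def)
      have "f \<in> weighted_span R k H m" using f U(3) H(2) by (auto simp: contained_in_def)
      then have "f \<otimes> \<gamma> [^] q \<in> power_span T m"
        using S(3) T(3)[of m] fq unfolding q_def by blast
      then have "g [^] q \<otimes> (f \<otimes> \<gamma> [^] q) \<in> W m"
        unfolding m W_def G_def by (rule power_span_homogenize[OF Tc g(1) d])
      moreover have fc: "f \<in> carrier R" using graded_linear_series_carrier(1)[OF V f] .
      have "g [^] q \<otimes> (f \<otimes> \<gamma> [^] q) = f \<otimes> (g [^] q \<otimes> \<gamma> [^] q)"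
        using g fc by (simp add: R.m_ac)
      moreover have "g [^] q \<otimes> \<gamma> [^] q = \<one>"
        using R.nat_pow_distrib[OF g(1,2), of q] g(3) by simp
      ultimately show ?thesis using fc by simp
    qed
  qed
  have "?F = rational_function_field R k W"
  proof (rule rational_function_field_eqI[OF V W(1) VW])
    fix n f f' assume *: "1 \<le> n" "f \<in> W n" "f' \<in> W n" "f \<noteq> \<zero>" "f' \<noteq> \<zero>"
    obtain y y' where y: "y \<in> ?F" "f = g [^] (n div d) \<otimes> y" and y': "y' \<in> ?F" "f' = g [^] (n div d) \<otimes> y'"
      using * weighted_span_multiple[OF Fs rV(2) T(2) g(1) d] unfolding W_def G_def by metis
    have c: "g [^] (n div d) \<in> carrier R" "y \<in> carrier R" "y' \<in> carrier R"
        "f' \<in> carrier R" "inv f' \<in> carrier R"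
      using y y' Fc g(1) graded_linear_series_carrier(1)[OF W(1) *(3)] *(5) R.field_Units by auto
    have "y' \<noteq> \<zero>" using *(5) y' c by auto
    then have i: "inv y' \<in> ?F" "y' \<otimes> inv y' = \<one>"
      using R.subfield_m_inv[OF rV(1), of y'] y' by auto
    have ic: "inv y' \<in> carrier R" using i Fc by blast
    have "f = y \<otimes> inv y' \<otimes> f'"
    proof -
      have "y \<otimes> inv y' \<otimes> f' = g [^] (n div d) \<otimes> y \<otimes> (y' \<otimes> inv y')"
        unfolding y'(2) using c ic by (simp add: R.m_ac)
      then show ?thesis using i c y by simp
    qed
    then have "f \<otimes> inv f' = y \<otimes> inv y' \<otimes> (f' \<otimes> inv f')"
      using c ic by (simp add: R.m_assoc)
    also have "\<dots> = y \<otimes> inv y'"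
      using c ic R.field_Units *(5) by auto
    finally show "f \<otimes> inv f' \<in> ?F"
      using subringE(6)[OF Fs y(1) i(1)] by simp
  qed
  then show ?thesis using W VW by blast
qed

end

theorem theorem1p2:
  fixes K :: "('a, 'b) ring_scheme" and k :: "'a set" and V :: "nat \<Rightarrow> 'a set"
  assumes "field K" and "subfield k K"
    and "finitely_generated_extension K k"
    and "graded_linear_series K k V"
    and "subfinite_type K k V"
  shows "\<exists>W. graded_linear_series K k W \<and> finite_type K k W \<and> contained_in V W \<and>
    rational_function_field K k V = rational_function_field K k W"
proof -
  interpret field K by (rule assms(1))
  interpret field_with_subfield K k
    by (intro field_with_subfield.intro field_with_subfield_axioms.intro assms(1,2))
  show ?thesis using subfinite_type_imp_finite_type_hull assms(4,5) by blast
qed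

end
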